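(* Let $d\ge 1$, $n\ge 1$, and let $X_1,\dots,X_n$ be i.i.d. $\mathbb{R}^d$-valued random variables with Lebesgue density $f\in L^1(\mathbb{R}^d)\cap L^2(\mathbb{R}^d)$. Let $\kappa>0$ and let $\hat f_n$ be the thresholded Fourier estimator with threshold $\kappa_n n^{-1/2}$, $\kappa_n=1+\kappa\sqrt{\log n}$ (defined in the context). Then $$ \mathbb{E}\big[\|\hat f_n-f\|^2\big]\le \inf_{m\in[0,n]^d,\;A\in\mathcal{A}}\left(18\,\|f-f_{A,m}\|^2+\frac{\big(10+2(1+(\kappa+2)\sqrt{\log n})^2\big)\,|\det(A)|}{\pi^d n}\,m_1\cdots m_d\right)+\frac{64}{\pi^d}\,n^{d-\kappa^2/4}. $$
   Context: $\|g\|^2=\int_{\mathbb{R}^d}|g(x)|^2\,dx$. The Fourier transform of $g\in L^1(\mathbb{R}^d)$ is $\mathcal{F}g(u)=\int_{\mathbb{R}^d}e^{i\langle u,x\rangle}g(x)\,dx$. The empirical characteristic function is $\hat\varphi_{X,n}(u)=\frac1n\sum_{j=1}^n e^{i\langle u,X_j\rangle}$, $u\in\mathbb{R}^d$. With $\kappa_n=1+\kappa\sqrt{\log n}$, set $\tilde\varphi_{X,n}(u)=\hat\varphi_{X,n}(u)\mathbf{1}_{\{|\hat\varphi_{X,n}(u)|\ge \kappa_n n^{-1/2}\}}$ and define the (complex-valued) estimator $$\hat f_n(x)=\frac1{(2\pi)^d}\int_{[-n,n]^d}e^{-i\langle u,x\rangle}\tilde\varphi_{X,n}(u)\,du,\quad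 x\in\mathbb{R}^d.$$ $\mathcal{A}$ is the class of invertible real $d\times d$ matrices $A$ with $A([-1,1]^d)\subseteq[-1,1]^d$. For $m=(m_1,\dots,m_d)\in\mathbb{R}_+^d$, $[-m,m]=[-m_1,m_1]\times\cdots\times[-m_d,m_d]$, and $f_{A,m}$ is the uniquely defined function in $L^2(\mathbb{R}^d)$ with Fourier transform $\mathcal{F}f_{A,m}=(\mathcal{F}f)\mathbf{1}_{A([-m,m])}$. *)

theory Defs
  imports "HOL-Probability.Probability"
begin

definition L2_norm_sq :: "(real^'d \<Rightarrow> complex) \<Rightarrow> ennreal" where
  "L2_norm_sq g = (\<integral>\<^sup>+ x. ennreal ((norm (g x))\<^sup>2) \<partial>lborel)"

definition is_L2 :: "(real^'d \<Rightarrow> complex) \<Rightarrow> bool" where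
  "is_L2 g \<longleftrightarrow> g \<in> borel_measurable lborel \<and> L2_norm_sq g < \<infinity>"

text \<open>The integral is only meaningful for integrable \<open>g\<close>.\<close>

definition fourier :: "(real^'d \<Rightarrow> complex) \<Rightarrow> real^'d \<Rightarrow> complex" where
  "fourier g u = (LINT x|lborel. iexp (u \<bullet> x) * g x)"

text \<open>
  The Fourier transform on square-integrable functions is the continuous extension of the integral
  transform from the intersection with the integrable functions. Since its values are determined
  only almost everywhere, it is expressed as a relation between representatives:
  \<open>h\<close> is a Fourier transform of \<open>g\<close>.
\<close>

definition has_L2_fourier :: "(real^'d \<Rightarrow> complex) \<Rightarrow> (real^'d \<Rightarrow> complex) \<Rightarrow> bool" where
  "has_L2_fourier g h \<longleftrightarrow> is_L2 g \<and> is_L2 h \<and>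
     (\<exists>G :: nat \<Rightarrow> real^'d \<Rightarrow> complex.
        (\<forall>k. integrable lborel (G k) \<and> is_L2 (G k)) \<and>
        (\<lambda>k. L2_norm_sq (\<lambda>x. G k x - g x)) \<longlonglongrightarrow> 0 \<and>
        (\<lambda>k. L2_norm_sq (\<lambda>u. fourier (G k) u - h u)) \<longlonglongrightarrow> 0)"

definition sym_box :: "real^'d \<Rightarrow> (real^'d) set" where
  "sym_box m = cbox (- m) m"

definition matrix_class :: "(real^'d^'d) set" where
  "matrix_class = {A. invertible A \<and> (*v) A ` sym_box (\<chi> i. 1) \<subseteq> sym_box (\<chi> i. 1)}"

text \<open>
  The function \<open>f\<^bsub>A,m\<^esub>\<close>. The description determines it up to a null set; \<open>SOME\<close> picks a representative.
\<close>

definition spectral_cutoff ::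
    "(real^'d \<Rightarrow> complex) \<Rightarrow> real^'d^'d \<Rightarrow> real^'d \<Rightarrow> real^'d \<Rightarrow> complex" where
  "spectral_cutoff f A m =
     (SOME g. has_L2_fourier g (\<lambda>u. fourier f u * indicator ((*v) A ` sym_box m) u))"

definition emp_char :: "nat \<Rightarrow> (nat \<Rightarrow> real^'d) \<Rightarrow> real^'d \<Rightarrow> complex" where
  "emp_char n x u = (1 / of_nat n) * (\<Sum>j=1..n. iexp (u \<bullet> x j))"

definition kappa_n :: "real \<Rightarrow> nat \<Rightarrow> real" where
  "kappa_n \<kappa> n = 1 + \<kappa> * sqrt (ln (real n))"

definition thresh_char :: "real \<Rightarrow> nat \<Rightarrow> (nat \<Rightarrow> real^'d) \<Rightarrow> real^'d \<Rightarrow> complex" where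
  "thresh_char \<kappa> n x u =
     emp_char n x u * indicator {v. norm (emp_char n x v) \<ge> kappa_n \<kappa> n * real n powr (- 1/2)} u"

definition fourier_estimator ::
    "real \<Rightarrow> nat \<Rightarrow> (nat \<Rightarrow> real^'d) \<Rightarrow> real^'d \<Rightarrow> complex" where
  "fourier_estimator \<kappa> n x y =
     1 / (2 * of_real pi) ^ CARD('d) *
       (LINT u:sym_box (\<chi> i. real n)|lborel. iexp (- (u \<bullet> y)) * thresh_char \<kappa> n x u)"

end

theory Submission
  imports Defs
begin

text \<open>
  The estimator is compared with an oracle that knows the transform \<open>\<phi> = fourier f\<close> and keeps exactly the
  frequencies in \<open>S = A [-m, m]\<close>. By Plancherel's theorem the loss is \<open>(2 * pi) ^ (- d)\<close> times the squared
  \<open>L\<^sup>2\<close> distance between \<open>\<phi>\<close> and the thresholded empirical characteristic function restricted to the box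
  \<open>Q = [-n, n] ^ d\<close>, and by Tonelli's theorem its expectation may be bounded separately at each frequency.

  On \<open>S\<close>, which lies in \<open>Q\<close> because \<open>A\<close> maps the unit box into itself, the expected loss is at most of the
  order of the squared threshold (\<open>risk_le_variance\<close>). Integrated over \<open>S\<close>, whose
  volume is \<open>abs (det A) * 2 ^ d * \<Prod> m\<close>, this is the variance term. On \<open>Q - S\<close> the expected loss is at most
  \<open>18 * (norm \<phi>)\<^sup>2\<close> plus a multiple of the probability that noise passes the threshold, which Hoeffding's inequality bounds by
  a multiple of \<open>n powr (- \<kappa>\<^sup>2 / 4)\<close> (\<open>risk_le_bias\<close>); integrated over \<open>Q\<close>, the latter is the final remainder.
  Outside \<open>Q\<close> the loss is \<open>(norm \<phi>)\<^sup>2\<close>. The parts with \<open>\<phi>\<close> add up to at most \<open>18\<close> times the squared norm of \<open>\<phi>\<close>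
  off \<open>S\<close>, which is the bias by Plancherel again (\<open>spectral_cutoff_error_ge\<close>).

  The analytic side is Plancherel's theorem on \<open>\<real>\<^sup>d\<close> for functions in \<open>L\<^sup>1 \<inter> L\<^sup>2\<close>. It is obtained by damping
  \<open>(norm \<phi>)\<^sup>2\<close> with a wide Gaussian: the damped integral is a Gaussian average of the autocorrelation of \<open>f\<close>,
  which is continuous at \<open>0\<close> since translation is continuous in \<open>L\<^sup>1\<close> (\<open>plancherel\<close>). The estimator and the
  cut-off are inverse transforms of compactly supported functions and need not be integrable, so the identity
  is extended to distances between such inverse transforms and functions in \<open>L\<^sup>1 \<inter> L\<^sup>2\<close> (\<open>plancherel_mixed\<close>).
\<close>

section \<open>Gaussian integrals in several dimensions\<close>

lemma
  fixes f :: "'a::euclidean_space \<Rightarrow> real \<Rightarrow> 'b::{real_normed_field,banach,second_countable_topology}"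
  assumes f: "\<And>b. b \<in> Basis \<Longrightarrow> integrable lborel (f b)"
  shows integrable_lborel_prod_Basis: "integrable lborel (\<lambda>x::'a. \<Prod>b\<in>Basis. f b (x \<bullet> b))" (is ?I)
    and integral_lborel_prod_Basis:
      "(LINT x|lborel. (\<Prod>b\<in>(Basis::'a set). f b (x \<bullet> b))) = (\<Prod>b\<in>Basis. (LINT x|lborel. f b x))" (is ?E)
proof -
  interpret product_sigma_finite "\<lambda>_::'a. lborel :: real measure" ..
  have [measurable]: "\<And>b. b \<in> Basis \<Longrightarrow> f b \<in> borel_measurable borel"
    using borel_measurable_integrable[OF f] by simp
  have eq: "(\<Prod>b\<in>Basis. f b ((\<Sum>c\<in>Basis. x c *\<^sub>R c) \<bullet> b)) = (\<Prod>b\<in>Basis. f b (x b))" for x :: "'a \<Rightarrow> real"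
    by (intro prod.cong refl) simp
  have m: "(\<lambda>x::'a \<Rightarrow> real. \<Sum>b\<in>Basis. x b *\<^sub>R b) \<in> (\<Pi>\<^sub>M b\<in>Basis. lborel) \<rightarrow>\<^sub>M borel"
    by measurable
  have mf: "(\<lambda>x::'a. \<Prod>b\<in>Basis. f b (x \<bullet> b)) \<in> borel_measurable borel"
    by measurable
  show ?I
    unfolding lborel_eq[where 'a='a] integrable_distr_eq[OF m mf] eq
    by (intro product_integrable_prod f) simp_all
  show ?E
    unfolding lborel_eq[where 'a='a] integral_distr[OF m mf] eq
    by (intro product_integral_prod f) simp_all
qed

lemma integrable_gauss_real: "integrable lborel (\<lambda>x::real. exp (- x\<^sup>2 / 2))"
proof -
  have "integrable lborel (\<lambda>x. sqrt (2 * pi) * std_normal_density x)"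
    by (intro integrable_mult_right) simp
  then show ?thesis
    by (simp add: std_normal_density_def)
qed

lemma fourier_gauss_real:
  "(LINT x|lborel. iexp (x * t) * complex_of_real (exp (- x\<^sup>2 / 2))) = sqrt (2 * pi) * exp (- t\<^sup>2 / 2)"
proof -
  have "complex_of_real (exp (- t\<^sup>2 / 2)) = char std_normal_distribution t"
    by (simp add: char_std_normal_distribution)
  also have "\<dots> = (LINT x|lborel. std_normal_density x *\<^sub>R iexp (t * x))"
    unfolding char_def by (subst integral_density) (auto simp: normal_density_nonneg)
  also have "\<dots> = (LINT x|lborel. (iexp (x * t) * complex_of_real (exp (- x\<^sup>2 / 2))) * complex_of_real (1 / sqrt (2 * pi)))"
    by (intro Bochner_Integration.integral_cong refl)
       (simp add: std_normal_density_def scaleR_conv_of_real mult_ac)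
  also have "\<dots> = (LINT x|lborel. (iexp (x * t) * complex_of_real (exp (- x\<^sup>2 / 2)))) * complex_of_real (1 / sqrt (2 * pi))"
    by (rule integral_mult_left_zero)
  finally show ?thesis
    by (simp add: field_simps)
qed

definition gauss :: "'a::euclidean_space \<Rightarrow> real" where
  "gauss x = exp (- (x \<bullet> x) / 2)"

lemma gauss_measurable [measurable]: "gauss \<in> borel_measurable borel"
  unfolding gauss_def by measurable

lemma gauss_nonneg [simp]: "0 \<le> gauss x"
  and gauss_0 [simp]: "gauss 0 = 1"
  by (auto simp: gauss_def)

lemma gauss_prod: "gauss x = (\<Prod>b\<in>Basis. exp (- (x \<bullet> b)\<^sup>2 / 2))"
  unfolding gauss_def euclidean_inner[of x x]
  by (simp add: exp_sum[symmetric] sum_negf sum_divide_distrib power2_eq_square)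

lemma integrable_gauss: "integrable lborel (gauss :: 'a::euclidean_space \<Rightarrow> real)"
  using integrable_lborel_prod_Basis[where 'a='a, OF integrable_gauss_real]
  by (simp add: gauss_prod[abs_def])

text \<open>
  The Gaussian and the exponential are both products over the coordinates, so the transform in
  dimension \<open>d\<close> is a product of one-dimensional ones.
\<close>

lemma fourier_gauss:
  "fourier (\<lambda>x. complex_of_real (gauss x)) (w::real^'d) = complex_of_real (sqrt (2 * pi) ^ CARD('d) * gauss w)"
proof -
  have int: "integrable lborel (\<lambda>x. iexp (x * t) * complex_of_real (exp (- x\<^sup>2 / 2)))" for t
    by (rule Bochner_Integration.integrable_bound[OF integrable_gauss_real]) (auto simp: norm_mult)
  have "iexp (w \<bullet> x) * complex_of_real (gauss x)
      = (\<Prod>b\<in>Basis. iexp ((x \<bullet> b) * (w \<bullet> b)) * complex_of_real (exp (- (x \<bullet> b)\<^sup>2 / 2)))" for x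
    unfolding gauss_prod euclidean_inner[of w x]
    by (simp add: prod.distrib exp_sum sum_distrib_left mult_ac)
  then have "fourier (\<lambda>x. complex_of_real (gauss x)) w
      = (\<Prod>b\<in>(Basis::(real^'d) set). (LINT x|lborel. iexp (x * (w \<bullet> b)) * complex_of_real (exp (- x\<^sup>2 / 2))))"
    unfolding fourier_def by (simp only: integral_lborel_prod_Basis[OF int])
  also have "\<dots> = complex_of_real (sqrt (2 * pi) ^ CARD('d) * gauss w)"
    unfolding fourier_gauss_real gauss_prod by (simp add: prod.distrib)
  finally show ?thesis .
qed

lemma integral_gauss: "(LINT x|lborel. gauss (x::real^'d)) = sqrt (2 * pi) ^ CARD('d)"
proof -
  have "complex_of_real (LINT x|lborel. gauss (x::real^'d)) = fourier (\<lambda>x. complex_of_real (gauss x)) (0::real^'d)"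
    unfolding fourier_def by simp
  also have "\<dots> = complex_of_real (sqrt (2 * pi) ^ CARD('d))"
    unfolding fourier_gauss by simp
  finally show ?thesis by (simp only: of_real_eq_iff)
qed

section \<open>Translations\<close>

lemma nn_integral_lborel_affine:
  fixes f :: "'a::euclidean_space \<Rightarrow> ennreal"
  assumes c: "c \<noteq> 0" and [measurable]: "f \<in> borel_measurable borel"
  shows "(\<integral>\<^sup>+x. f x \<partial>lborel) = ennreal (\<bar>c\<bar> ^ DIM('a)) * (\<integral>\<^sup>+x. f (t + c *\<^sub>R x) \<partial>lborel)"
  by (subst lborel_affine[OF c, of t])
     (simp add: nn_integral_density nn_integral_distr nn_integral_cmult)

lemma integrable_lborel_affine:
  fixes f :: "'a::euclidean_space \<Rightarrow> 'b::{banach, second_countable_topology}"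
  assumes "integrable lborel f" and "c \<noteq> 0"
  shows "integrable lborel (\<lambda>x. f (t + c *\<^sub>R x))"
  using assms(1) assms(1)[THEN borel_measurable_integrable] \<open>c \<noteq> 0\<close>
  unfolding integrable_iff_bounded
  by (subst (asm) nn_integral_lborel_affine[where c=c and t=t]) (auto simp: ennreal_mult_less_top)

lemma integral_lborel_affine:
  fixes f :: "'a::euclidean_space \<Rightarrow> 'b::{banach, second_countable_topology}"
  assumes "f \<in> borel_measurable borel" and c: "c \<noteq> 0"
  shows "(LINT x|lborel. f x) = \<bar>c\<bar> ^ DIM('a) *\<^sub>R (LINT x|lborel. f (t + c *\<^sub>R x))"
  using assms
  by (subst lborel_affine[OF c, of t]) (simp add: integral_density integral_distr)

lemma integrable_translate:
  fixes f :: "'a::euclidean_space \<Rightarrow> 'b::{banach, second_countable_topology}"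
  assumes "integrable lborel f"
  shows "integrable lborel (\<lambda>x. f (x + z))"
  using integrable_lborel_affine[OF assms, of 1 z] by (simp add: add.commute)

lemma integral_translate:
  fixes f :: "'a::euclidean_space \<Rightarrow> 'b::{banach, second_countable_topology}"
  assumes "f \<in> borel_measurable borel"
  shows "(LINT x|lborel. f (x + z)) = (LINT x|lborel. f x)"
  using integral_lborel_affine[OF assms, of 1 z] by (simp add: add.commute)

lemma translation_error_le:
  fixes f g :: "'a::euclidean_space \<Rightarrow> 'b::{banach, second_countable_topology}"
  assumes f: "integrable lborel f" and g: "integrable lborel g"
  shows "(LINT x|lborel. norm (f (x + z) - f x))
    \<le> (LINT x|lborel. norm (g (x + z) - g x)) + 2 * (LINT x|lborel. norm (f x - g x))"
proof -
  have d: "integrable lborel (\<lambda>x. norm (f x - g x))"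
    using f g by auto
  have fz: "integrable lborel (\<lambda>x. f (x + z))" by (rule integrable_translate[OF f])
  have gz: "integrable lborel (\<lambda>x. g (x + z))" by (rule integrable_translate[OF g])
  have "(LINT x|lborel. norm (f (x + z) - f x))
    \<le> (LINT x|lborel. norm (g (x + z) - g x) + (norm (f (x + z) - g (x + z)) + norm (f x - g x)))"
  proof (rule integral_mono)
    fix x
    have "f (x + z) - f x = (g (x + z) - g x) + ((f (x + z) - g (x + z)) - (f x - g x))" by simp
    then show "norm (f (x + z) - f x)
        \<le> norm (g (x + z) - g x) + (norm (f (x + z) - g (x + z)) + norm (f x - g x))"
      by (simp only:) (rule order_trans[OF norm_triangle_ineq add_left_mono[OF norm_triangle_ineq4]])
  qed (use f g fz gz in auto)
  also have "\<dots> = (LINT x|lborel. norm (g (x + z) - g x))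
      + ((LINT x|lborel. norm (f (x + z) - g (x + z))) + (LINT x|lborel. norm (f x - g x)))"
    using f g fz gz by simp
  also have "(LINT x|lborel. norm (f (x + z) - g (x + z))) = (LINT x|lborel. norm (f x - g x))"
    using integral_translate[of "\<lambda>x. norm (f x - g x)" z] borel_measurable_integrable[OF d] by simp
  finally show ?thesis by simp
qed

text \<open>
  Convergence to zero may be tested up to an arbitrarily small additive error; this is how density
  arguments enter below.
\<close>

lemma tendsto_le_approx:
  fixes a :: "nat \<Rightarrow> real"
  assumes "\<And>k. 0 \<le> a k" and "\<And>e. e > 0 \<Longrightarrow> \<exists>b. b \<longlonglongrightarrow> 0 \<and> (\<forall>k. a k \<le> b k + e)"
  shows "a \<longlonglongrightarrow> 0"
proof (rule LIMSEQ_I)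
  fix r :: real assume "0 < r"
  then obtain b where b: "b \<longlonglongrightarrow> 0" "\<And>k. a k \<le> b k + r / 2"
    using assms(2)[of "r / 2"] by auto
  from order_tendstoD(2)[OF b(1), of "r / 2"] \<open>0 < r\<close>
  obtain N where "\<And>k. k \<ge> N \<Longrightarrow> b k < r / 2" by (auto simp: eventually_sequentially)
  with b(2) assms(1) show "\<exists>no. \<forall>n\<ge>no. norm (a n - 0) < r"
    by (intro exI[of _ N]) (smt (verit) field_sum_of_halves real_norm_def diff_zero)
qed

text \<open>
  Along a null sequence the points of an open set eventually stay inside it after translation, so the
  overlap of \<open>U\<close> with its translates recovers all of its measure by dominated convergence. The measure
  of the symmetric difference is then read off from that of the overlap.
\<close>

lemma translation_continuous_open:
  fixes U :: "'a::euclidean_space set"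
  assumes U: "open U" "emeasure lborel U < \<infinity>" and z: "z \<longlonglongrightarrow> 0"
  shows "(\<lambda>k. LINT x|lborel. \<bar>indicator U (x + z k) - indicator U x :: real\<bar>) \<longlonglongrightarrow> 0"
proof -
  have [measurable]: "U \<in> sets borel" using U by simp
  define h where "h = (\<lambda>k x. indicator U (x + z k) * indicator U x :: real)"
  have iU: "integrable lborel (indicator U :: 'a \<Rightarrow> real)"
    using U by (simp add: integrable_indicator_iff)
  have ih: "integrable lborel (h k)" for k
    by (rule Bochner_Integration.integrable_bound[OF iU])
       (auto simp: h_def split: split_indicator)
  have "(\<lambda>k. integral\<^sup>L lborel (h k)) \<longlonglongrightarrow> integral\<^sup>L lborel (indicator U :: 'a \<Rightarrow> real)"
  proof (rule integral_dominated_convergence[OF _ _ iU])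
    show "AE x in lborel. (\<lambda>k. h k x) \<longlonglongrightarrow> indicator U x"
    proof (rule AE_I2)
      fix x
      show "(\<lambda>k. h k x) \<longlonglongrightarrow> indicator U x"
      proof (cases "x \<in> U")
        case True
        have "(\<lambda>k. x + z k) \<longlonglongrightarrow> x + 0" by (intro tendsto_intros z)
        then have "eventually (\<lambda>k. x + z k \<in> U) sequentially"
          using U True by (auto simp: tendsto_def)
        then have "eventually (\<lambda>k. h k x = 1) sequentially"
          by eventually_elim (use True in \<open>simp add: h_def\<close>)
        then show ?thesis using True by (simp add: tendsto_eventually)
      qed (simp add: h_def)
    qed
  qed (auto simp: h_def split: split_indicator)
  then have "(\<lambda>k. 2 * integral\<^sup>L lborel (indicator U :: 'a \<Rightarrow> real) - 2 * integral\<^sup>L lborel (h k))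
      \<longlonglongrightarrow> 2 * integral\<^sup>L lborel (indicator U :: 'a \<Rightarrow> real) - 2 * integral\<^sup>L lborel (indicator U :: 'a \<Rightarrow> real)"
    by (intro tendsto_intros)
  moreover have "(LINT x|lborel. \<bar>indicator U (x + z k) - indicator U x :: real\<bar>)
      = 2 * integral\<^sup>L lborel (indicator U :: 'a \<Rightarrow> real) - 2 * integral\<^sup>L lborel (h k)" for k
  proof -
    have "(LINT x|lborel. \<bar>indicator U (x + z k) - indicator U x :: real\<bar>)
        = (LINT x|lborel. indicator U (x + z k) + indicator U x - 2 * h k x)"
      by (intro Bochner_Integration.integral_cong) (auto simp: h_def split: split_indicator)
    also have "\<dots> = (LINT x|lborel. indicator U (x + z k)) + integral\<^sup>L lborel (indicator U :: 'a \<Rightarrow> real)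
        - 2 * integral\<^sup>L lborel (h k)"
      using iU ih integrable_translate[OF iU, of "z k"] by simp
    also have "(LINT x|lborel. indicator U (x + z k) :: real) = integral\<^sup>L lborel (indicator U)"
      using integral_translate[of "indicator U :: 'a \<Rightarrow> real"] by simp
    finally show ?thesis by simp
  qed
  ultimately show ?thesis by simp
qed

text \<open>
  By outer regularity an indicator is \<open>L\<^sup>1\<close>-close to that of an open set, and the error of
  approximation changes the translation error by at most twice its norm; linearity and limits give
  all integrable functions.
\<close>

lemma translation_continuous_L1:
  fixes f :: "'a::euclidean_space \<Rightarrow> 'b::{banach, second_countable_topology}"
  assumes "integrable lborel f" and z: "z \<longlonglongrightarrow> 0"
  shows "(\<lambda>k. LINT x|lborel. norm (f (x + z k) - f x)) \<longlonglongrightarrow> 0"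
  using assms(1)
proof (induction rule: integrable_induct)
  case (base A c)
  then have [measurable]: "A \<in> sets borel" by simp
  show ?case
  proof (rule tendsto_le_approx)
    fix e :: real assume "e > 0"
    define r where "r = norm c + 1"
    have r: "r > 0" "norm c \<le> r" by (auto simp: r_def add_nonneg_pos)
    \<comment> \<open>The approximation error enters twice, and \<open>r\<close> replaces \<open>norm c\<close> since that may vanish.\<close>
    define d where "d = e / (2 * r)"
    have "d > 0" using \<open>e > 0\<close> r by (simp add: d_def)
    obtain U where U: "open U" "A \<subseteq> U" "emeasure lborel (U - A) < d"
      using outer_regular_lborel[OF \<open>A \<in> sets borel\<close> \<open>d > 0\<close>] by metis
    then have [measurable]: "U \<in> sets borel" by simp
    have UA: "emeasure lborel (U - A) < \<infinity>" using U(3) by (rule less_trans) simp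
    have "emeasure lborel U \<le> emeasure lborel A + emeasure lborel (U - A)"
      using U(2) by (intro order_trans[OF _ emeasure_subadditive] emeasure_mono) auto
    also have "\<dots> < \<infinity>" using base(2) UA by simp
    finally have Ufin: "emeasure lborel U < \<infinity>" .
    let ?f = "\<lambda>x. indicator A x *\<^sub>R c" and ?g = "\<lambda>x. indicator U x *\<^sub>R c"
    have "(LINT x|lborel. norm (?f (x + z k) - ?f x)) \<le>
        (LINT x|lborel. \<bar>indicator U (x + z k) - indicator U x :: real\<bar>) * norm c + e" for k
    proof -
      have "(LINT x|lborel. norm (?f (x + z k) - ?f x)) \<le>
          (LINT x|lborel. norm (?g (x + z k) - ?g x)) + 2 * (LINT x|lborel. norm (?f x - ?g x))"
        using base Ufin by (intro translation_error_le) auto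
      also have "(LINT x|lborel. norm (?g (x + z k) - ?g x))
          = (LINT x|lborel. \<bar>indicator U (x + z k) - indicator U x :: real\<bar> * norm c)"
        by (simp flip: scaleR_diff_left)
      also have "(LINT x|lborel. norm (?f x - ?g x)) = (LINT x|lborel. indicator (U - A) x * norm c)"
        using U(2) by (intro Bochner_Integration.integral_cong refl) (auto split: split_indicator)
      also have "\<dots> = measure lborel (U - A) * norm c"
        using UA by simp
      finally have le: "(LINT x|lborel. norm (?f (x + z k) - ?f x))
          \<le> (LINT x|lborel. \<bar>indicator U (x + z k) - indicator U x :: real\<bar> * norm c)
            + 2 * (measure lborel (U - A) * norm c)" .
      have "measure lborel (U - A) \<le> d"
        using U(3) \<open>d > 0\<close> by (simp add: measure_def enn2real_leI less_imp_le)
      then have "2 * (measure lborel (U - A) * norm c) \<le> 2 * (d * norm c)"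
        by (simp add: mult_right_mono)
      also have "\<dots> \<le> 2 * (d * r)"
        using \<open>d > 0\<close> r by (simp add: mult_left_mono)
      also have "\<dots> = e"
        using r by (simp add: d_def)
      finally have "2 * (measure lborel (U - A) * norm c) \<le> e" .
      then show ?thesis using le unfolding integral_mult_left_zero by linarith
    qed
    moreover have "(\<lambda>k. (LINT x|lborel. \<bar>indicator U (x + z k) - indicator U x :: real\<bar>) * norm c) \<longlonglongrightarrow> 0"
      using tendsto_mult_right[OF translation_continuous_open[OF U(1) Ufin z], of "norm c"]
      unfolding mult_zero_left .
    ultimately show "\<exists>b. b \<longlonglongrightarrow> 0 \<and> (\<forall>k. (LINT x|lborel. norm (?f (x + z k) - ?f x)) \<le> b k + e)"
      by blast
  qed simp
next
  case (add f g)
  have "(\<lambda>k. (LINT x|lborel. norm (f (x + z k) - f x)) + (LINT x|lborel. norm (g (x + z k) - g x))) \<longlonglongrightarrow> 0 + 0"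
    by (intro tendsto_add add)
  then have lim: "(\<lambda>k. (LINT x|lborel. norm (f (x + z k) - f x)) + (LINT x|lborel. norm (g (x + z k) - g x))) \<longlonglongrightarrow> 0"
    by simp
  show ?case
  proof (rule tendsto_sandwich[OF _ _ tendsto_const lim])
    show "\<forall>\<^sub>F k in sequentially. (LINT x|lborel. norm (f (x + z k) + g (x + z k) - (f x + g x)))
        \<le> (LINT x|lborel. norm (f (x + z k) - f x)) + (LINT x|lborel. norm (g (x + z k) - g x))"
    proof (rule always_eventually, rule allI)
      fix k
      have int: "integrable lborel (\<lambda>x. f (x + z k))" "integrable lborel (\<lambda>x. g (x + z k))"
        by (rule integrable_translate[OF add(1)], rule integrable_translate[OF add(2)])
      have "(LINT x|lborel. norm (f (x + z k) + g (x + z k) - (f x + g x)))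
        \<le> (LINT x|lborel. norm (f (x + z k) - f x) + norm (g (x + z k) - g x))"
        using add(1,2) int by (intro integral_mono) (auto intro: norm_diff_triangle_ineq)
      then show "(LINT x|lborel. norm (f (x + z k) + g (x + z k) - (f x + g x)))
        \<le> (LINT x|lborel. norm (f (x + z k) - f x)) + (LINT x|lborel. norm (g (x + z k) - g x))"
        using add(1,2) int by (subst (asm) Bochner_Integration.integral_add) auto
    qed
  qed auto
next
  case (lim f s)
  have "(\<lambda>i. LINT x|lborel. norm (f x - s i x)) \<longlonglongrightarrow> (LINT x|(lborel::'a measure). 0)"
  proof (rule integral_dominated_convergence[where w="\<lambda>x. 3 * norm (f x)"])
    show "AE x in lborel. (\<lambda>i. norm (f x - s i x)) \<longlonglongrightarrow> 0"
    proof (rule AE_I2)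
      fix x
      have "(\<lambda>i. norm (f x - s i x)) \<longlonglongrightarrow> norm (f x - f x)"
        using lim(2)[of x] by (intro tendsto_intros) auto
      then show "(\<lambda>i. norm (f x - s i x)) \<longlonglongrightarrow> 0" by simp
    qed
    show "AE x in lborel. norm (norm (f x - s i x)) \<le> 3 * norm (f x)" for i
    proof (rule AE_I2)
      fix x
      have "norm (s i x) \<le> 2 * norm (f x)" using lim(3)[of x i] by simp
      then show "norm (norm (f x - s i x)) \<le> 3 * norm (f x)"
        using norm_triangle_ineq4[of "f x" "s i x"] by simp
    qed
  qed (use lim(1,4) in auto)
  then have lim0: "(\<lambda>i. LINT x|lborel. norm (f x - s i x)) \<longlonglongrightarrow> 0" by simp
  show ?case
  proof (rule tendsto_le_approx)
    fix e :: real assume "e > 0"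
    with order_tendstoD(2)[OF lim0, of "e / 2"]
    obtain i where i: "(LINT x|lborel. norm (f x - s i x)) < e / 2"
      by (auto simp: eventually_sequentially)
    have "(LINT x|lborel. norm (f (x + z k) - f x)) \<le> (LINT x|lborel. norm (s i (x + z k) - s i x)) + e" for k
      using translation_error_le[OF lim(4) lim(1)[of i], of "z k"] i by simp
    then show "\<exists>b. b \<longlonglongrightarrow> 0 \<and> (\<forall>k. (LINT x|lborel. norm (f (x + z k) - f x)) \<le> b k + e)"
      using lim(5)[of i] by blast
  qed simp
qed

section \<open>The Fourier transform of integrable functions\<close>

lemma cnj_measurable [measurable]: "cnj \<in> borel_measurable borel"
  by (intro borel_measurable_continuous_onI continuous_intros)

lemma fourier_measurable [measurable]:
  fixes g :: "real^'d \<Rightarrow> complex"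
  assumes [measurable]: "g \<in> borel_measurable borel"
  shows "fourier g \<in> borel_measurable borel"
  unfolding fourier_def[abs_def] by measurable

lemma norm_fourier_le: "norm (fourier g u) \<le> (LINT x|lborel. norm (g x))"
proof -
  have "norm (fourier g u) \<le> (LINT x|lborel. norm (iexp (u \<bullet> x) * g x))"
    unfolding fourier_def by (rule integral_norm_bound)
  also have "\<dots> = (LINT x|lborel. norm (g x))"
    by (simp add: norm_mult)
  finally show ?thesis .
qed

lemma integrable_iexp_mult:
  fixes g :: "real^'d \<Rightarrow> complex"
  assumes "integrable lborel g"
  shows "integrable lborel (\<lambda>x. iexp (u \<bullet> x) * g x)"
  by (rule Bochner_Integration.integrable_bound[OF assms])
     (use borel_measurable_integrable[OF assms] in \<open>auto simp: norm_mult\<close>)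

lemma fourier_diff:
  assumes "integrable lborel f" "integrable lborel g"
  shows "fourier (\<lambda>x. f x - g x) u = fourier f u - fourier g u"
  unfolding fourier_def ring_distribs
  by (rule Bochner_Integration.integral_diff) (intro integrable_iexp_mult assms)+

lemma fourier_cnj: "fourier (\<lambda>x. cnj (g x)) u = cnj (fourier g (- u))"
proof -
  have eq: "iexp (u \<bullet> x) * cnj (g x) = cnj (iexp (- u \<bullet> x) * g x)" for x
    by (simp add: exp_cnj)
  show ?thesis
    unfolding fourier_def by (simp only: eq Bochner_Integration.integral_cnj)
qed

text \<open>
  The integrability premise of Fubini's theorem for kernels dominated by a tensor product, such as
  those obtained by multiplying a tensor product by a phase.
\<close>

lemma integrable_pair_bound:
  fixes p q :: "real^'d \<Rightarrow> complex" and k :: "(real^'d) \<times> (real^'d) \<Rightarrow> complex"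
  assumes p: "integrable lborel p" and q: "integrable lborel q"
    and k[measurable]: "k \<in> borel_measurable (lborel \<Otimes>\<^sub>M lborel)"
    and le: "\<And>x y. norm (k (x, y)) \<le> norm (p x) * norm (q y)"
  shows "integrable (lborel \<Otimes>\<^sub>M lborel) k"
proof -
  have [measurable]: "p \<in> borel_measurable borel" "q \<in> borel_measurable borel"
    using p q by auto
  have "integrable (lborel \<Otimes>\<^sub>M lborel) (\<lambda>(x, y). p x * q y)"
  proof (rule lborel_pair.Fubini_integrable)
    show "integrable lborel (\<lambda>x. LINT y|lborel. norm (case (x, y) of (x, y) \<Rightarrow> p x * q y))"
      using p by (simp add: norm_mult)
    show "AE x in lborel. integrable lborel (\<lambda>y. case (x, y) of (x, y) \<Rightarrow> p x * q y)"
      using q by simp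
  qed measurable
  then show ?thesis
    by (rule Bochner_Integration.integrable_bound[OF _ k]) (auto simp: norm_mult le)
qed

text \<open>
  Both sides are the same double integral, evaluated in the two possible orders.
\<close>

lemma fourier_multiplication_formula:
  fixes f h :: "real^'d \<Rightarrow> complex"
  assumes f: "integrable lborel f" and h: "integrable lborel h"
  shows "(LINT u|lborel. fourier f u * h u) = (LINT x|lborel. f x * fourier h x)"
proof -
  have [measurable]: "f \<in> borel_measurable borel" "h \<in> borel_measurable borel"
    using f h by auto
  let ?k = "\<lambda>x u. iexp (u \<bullet> x) * f x * h u"
  have k: "integrable (lborel \<Otimes>\<^sub>M lborel) (case_prod ?k)"
    by (rule integrable_pair_bound[OF f h]) (auto simp: norm_mult)
  have "(LINT u|lborel. fourier f u * h u) = (LINT u|lborel. (LINT x|lborel. ?k x u))"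
    unfolding fourier_def by simp
  also have "\<dots> = (LINT x|lborel. (LINT u|lborel. ?k x u))"
    by (rule lborel_pair.Fubini_integral[OF k])
  also have "\<dots> = (LINT x|lborel. f x * fourier h x)"
    unfolding fourier_def integral_mult_right_zero[symmetric]
    by (simp add: mult_ac inner_commute)
  finally show ?thesis .
qed

lemma integral_reflect:
  fixes g :: "real^'d \<Rightarrow> complex"
  assumes "g \<in> borel_measurable borel"
  shows "(LINT x|lborel. g (- x)) = (LINT x|lborel. g x)"
  using integral_lborel_affine[OF assms, of "-1" 0] by simp

lemma integrable_reflect:
  fixes g :: "real^'d \<Rightarrow> 'b::{banach, second_countable_topology}"
  assumes "integrable lborel g"
  shows "integrable lborel (\<lambda>x. g (- x))"
  using integrable_lborel_affine[OF assms, of "-1" 0] by simp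

text \<open>
  The multiplication formula in sesquilinear form: up to the constant \<open>(2 * pi) ^ d\<close>, the adjoint of the
  Fourier transform is the inverse transform.
\<close>

lemma fourier_adjoint:
  fixes f h :: "real^'d \<Rightarrow> complex"
  assumes f: "integrable lborel f" and h: "integrable lborel h"
  shows "(LINT u|lborel. cnj (fourier f u) * h u) = (LINT x|lborel. cnj (f x) * fourier h (- x))"
proof -
  have [measurable]: "f \<in> borel_measurable borel" "h \<in> borel_measurable borel"
    using f h by auto
  have "(LINT u|lborel. cnj (fourier f u) * h u) = (LINT u|lborel. cnj (fourier f (- u)) * h (- u))"
    using integral_reflect[of "\<lambda>u. cnj (fourier f u) * h u"] by simp
  also have "\<dots> = (LINT u|lborel. fourier (\<lambda>x. cnj (f x)) u * h (- u))"
    by (simp add: fourier_cnj)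
  also have "\<dots> = (LINT x|lborel. cnj (f x) * fourier (\<lambda>u. h (- u)) x)"
    using f by (intro fourier_multiplication_formula integrable_reflect h) simp
  also have "\<dots> = (LINT x|lborel. cnj (f x) * fourier h (- x))"
  proof -
    have "fourier (\<lambda>u. h (- u)) x = fourier h (- x)" for x
      unfolding fourier_def using integral_reflect[of "\<lambda>u. iexp (- x \<bullet> u) * h u"] by simp
    then show ?thesis by simp
  qed
  finally show ?thesis .
qed

section \<open>Plancherel's theorem\<close>

lemma norm_mult_cnj_le: "norm (a * cnj b) \<le> ((norm a)\<^sup>2 + (norm b)\<^sup>2) / 2" for a b :: complex
  using sum_squares_bound[of "norm a" "norm b"] by (simp add: norm_mult)

text \<open>
  The value at \<open>0\<close> is the square of the \<open>L\<^sup>2\<close> norm; for other \<open>z\<close> this is the inverse Fourier transform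
  of the squared modulus of \<open>fourier f\<close>.
\<close>

definition autocorr :: "(real^'d \<Rightarrow> complex) \<Rightarrow> real^'d \<Rightarrow> complex" where
  "autocorr f z = (LINT y|lborel. f (y + z) * cnj (f y))"

lemma autocorr_measurable [measurable]:
  assumes [measurable]: "f \<in> borel_measurable borel"
  shows "autocorr f \<in> borel_measurable borel"
  unfolding autocorr_def[abs_def] by measurable

context
  fixes f :: "real^'d \<Rightarrow> complex"
  assumes f: "integrable lborel f" and f2: "integrable lborel (\<lambda>x. (norm (f x))\<^sup>2)"
begin

private lemma fm [measurable]: "f \<in> borel_measurable borel"
  using f by auto

private lemma f2z: "integrable lborel (\<lambda>y. (norm (f (y + z)))\<^sup>2)"
    "(LINT y|lborel. (norm (f (y + z)))\<^sup>2) = (LINT y|lborel. (norm (f y))\<^sup>2)"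
  using integrable_translate[OF f2, of z] integral_translate[of "\<lambda>x. (norm (f x))\<^sup>2" z] by auto

lemma integrable_autocorr: "integrable lborel (\<lambda>y. f (y + z) * cnj (f y))"
proof (rule Bochner_Integration.integrable_bound)
  show "integrable lborel (\<lambda>y. ((norm (f (y + z)))\<^sup>2 + (norm (f y))\<^sup>2) / 2)"
    using f2z[of z] f2 by simp
  show "AE y in lborel. norm (f (y + z) * cnj (f y)) \<le> norm (((norm (f (y + z)))\<^sup>2 + (norm (f y))\<^sup>2) / 2)"
    by (rule AE_I2) (use norm_mult_cnj_le in \<open>simp add: abs_of_nonneg\<close>)
qed simp

lemma integral_norm_autocorr_le:
  "(LINT y|lborel. norm (f (y + z) * cnj (f y))) \<le> (LINT y|lborel. (norm (f y))\<^sup>2)"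
proof -
  have "(LINT y|lborel. norm (f (y + z) * cnj (f y))) \<le> (LINT y|lborel. ((norm (f (y + z)))\<^sup>2 + (norm (f y))\<^sup>2) / 2)"
    by (rule integral_mono[OF integrable_norm[OF integrable_autocorr]])
       (use f2z[of z] f2 norm_mult_cnj_le in auto)
  also have "\<dots> = (LINT y|lborel. (norm (f y))\<^sup>2)"
    using f2z[of z] f2 by simp
  finally show ?thesis .
qed

lemma norm_autocorr_le: "norm (autocorr f z) \<le> (LINT y|lborel. (norm (f y))\<^sup>2)"
  unfolding autocorr_def by (rule order_trans[OF integral_norm_bound integral_norm_autocorr_le])

lemma autocorr_0: "autocorr f 0 = (LINT y|lborel. (norm (f y))\<^sup>2)"
  unfolding autocorr_def by (simp only: add_0_right complex_norm_square[symmetric] integral_complex_of_real)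

text \<open>
  The \<open>L\<^sup>2\<close> mass of \<open>f\<close> above height \<open>N\<close>. Truncating at height \<open>N\<close> is what lets the continuity of translation in
  \<open>L\<^sup>1\<close> control an \<open>L\<^sup>2\<close> quantity.
\<close>

private definition tail :: "nat \<Rightarrow> real" where
  "tail N = (LINT y|lborel. (norm (f y))\<^sup>2 * indicator {y. norm (f y) > real N} y)"

private lemma tail_integrable: "integrable lborel (\<lambda>y. (norm (f y))\<^sup>2 * indicator {y. norm (f y) > real N} y)"
  by (rule Bochner_Integration.integrable_bound[OF f2]) (auto split: split_indicator)

private lemma tail_tendsto: "tail \<longlonglongrightarrow> 0"
proof -
  have "tail \<longlonglongrightarrow> (LINT y|(lborel::(real^'d) measure). 0)"
    unfolding tail_def[abs_def]
  proof (rule integral_dominated_convergence[OF _ _ f2])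
    show "AE y in lborel. (\<lambda>N. (norm (f y))\<^sup>2 * indicator {y. norm (f y) > real N} y) \<longlonglongrightarrow> 0"
    proof (rule AE_I2)
      fix y
      have "eventually (\<lambda>N. real N \<ge> norm (f y)) sequentially"
        using filterlim_real_sequentially by (simp add: filterlim_at_top)
      then have "eventually (\<lambda>N. (norm (f y))\<^sup>2 * indicator {y. norm (f y) > real N} y = 0) sequentially"
        by eventually_elim auto
      then show "(\<lambda>N. (norm (f y))\<^sup>2 * indicator {y. norm (f y) > real N} y) \<longlonglongrightarrow> 0"
        by (rule tendsto_eventually)
    qed
  qed (auto split: split_indicator)
  then show ?thesis by simp
qed

text \<open>
  Where \<open>norm (f y) \<le> N\<close> the second factor of the autocorrelation is bounded by \<open>N\<close>, which leaves an
  \<open>L\<^sup>1\<close> translation error. On the remaining set the product is split by the weighted inequality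
  \<open>a * b \<le> d * a\<^sup>2 + b\<^sup>2 / d\<close>, so that the translated factor, whose mass there is not small, carries
  the small weight \<open>d\<close>.
\<close>

private lemma autocorr_diff_le:
  assumes "d > 0"
  shows "norm (autocorr f z - autocorr f 0)
    \<le> real N * (LINT y|lborel. norm (f (y + z) - f y))
      + (d * (LINT y|lborel. (norm (f y))\<^sup>2) + (1 / d + 1) * tail N)"
proof -
  let ?J = "\<lambda>y. (norm (f y))\<^sup>2 * indicator {y. norm (f y) > real N} y"
  let ?b = "\<lambda>y. real N * norm (f (y + z) - f y) + (d * (norm (f (y + z)))\<^sup>2 + (1 / d + 1) * ?J y)"
  have fz: "integrable lborel (\<lambda>y. f (y + z))" by (rule integrable_translate[OF f])
  have "autocorr f z - autocorr f 0 = (LINT y|lborel. f (y + z) * cnj (f y) - f (y + 0) * cnj (f y))"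
    unfolding autocorr_def by (rule Bochner_Integration.integral_diff[symmetric]) (rule integrable_autocorr)+
  also have "norm \<dots> \<le> (LINT y|lborel. norm (f (y + z) * cnj (f y) - f (y + 0) * cnj (f y)))"
    by (rule integral_norm_bound)
  also have "\<dots> \<le> (LINT y|lborel. ?b y)"
  proof (rule integral_mono)
    show "integrable lborel (\<lambda>y. norm (f (y + z) * cnj (f y) - f (y + 0) * cnj (f y)))"
      by (intro integrable_norm Bochner_Integration.integrable_diff integrable_autocorr)
    show "integrable lborel ?b"
      using f fz f2z(1)[of z] tail_integrable[of N] by auto
    fix y
    have e: "norm (f (y + z) * cnj (f y) - f (y + 0) * cnj (f y)) = norm (f (y + z) - f y) * norm (f y)"
      by (simp add: norm_mult flip: left_diff_distrib)
    show "norm (f (y + z) * cnj (f y) - f (y + 0) * cnj (f y)) \<le> ?b y"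
    proof (cases "norm (f y) > real N")
      case False
      then have "norm (f (y + z) - f y) * norm (f y) \<le> norm (f (y + z) - f y) * real N"
        by (intro mult_left_mono) auto
      then show ?thesis unfolding e using \<open>d > 0\<close> False by (simp add: mult.commute add_increasing2)
    next
      case True
      have "norm (f (y + z) - f y) * norm (f y) \<le> (norm (f (y + z)) + norm (f y)) * norm (f y)"
        by (intro mult_right_mono norm_triangle_ineq4) auto
      also have "\<dots> = norm (f (y + z)) * norm (f y) + (norm (f y))\<^sup>2"
        by (simp add: algebra_simps power2_eq_square)
      also have "norm (f (y + z)) * norm (f y) \<le> d * (norm (f (y + z)))\<^sup>2 + 1 / d * (norm (f y))\<^sup>2"
      proof -
        have "0 \<le> (d * norm (f (y + z)) - norm (f y))\<^sup>2" by simp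
        then have "2 * (d * (norm (f (y + z)) * norm (f y))) \<le> d\<^sup>2 * (norm (f (y + z)))\<^sup>2 + (norm (f y))\<^sup>2"
          by (simp add: power2_eq_square algebra_simps)
        also have "\<dots> = d * (d * (norm (f (y + z)))\<^sup>2 + 1 / d * (norm (f y))\<^sup>2)"
          using \<open>d > 0\<close> by (simp add: power2_eq_square algebra_simps)
        finally have "2 * (d * (norm (f (y + z)) * norm (f y)))
            \<le> d * (d * (norm (f (y + z)))\<^sup>2 + 1 / d * (norm (f y))\<^sup>2)" .
        moreover have "0 \<le> d * (norm (f (y + z)) * norm (f y))" using \<open>d > 0\<close> by simp
        ultimately have "d * (norm (f (y + z)) * norm (f y)) \<le> d * (d * (norm (f (y + z)))\<^sup>2 + 1 / d * (norm (f y))\<^sup>2)"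
          by linarith
        then show ?thesis using \<open>d > 0\<close> by (simp only: mult_le_cancel_left_pos)
      qed
      finally have "norm (f (y + z) - f y) * norm (f y)
          \<le> d * (norm (f (y + z)))\<^sup>2 + (1 / d + 1) * (norm (f y))\<^sup>2"
        by (simp add: algebra_simps)
      moreover have "0 \<le> real N * norm (f (y + z) - f y)" by simp
      ultimately show ?thesis unfolding e using True by (simp add: add_increasing)
    qed
  qed
  also have "\<dots> = real N * (LINT y|lborel. norm (f (y + z) - f y))
      + (d * (LINT y|lborel. (norm (f y))\<^sup>2) + (1 / d + 1) * tail N)"
  proof -
    have "integrable lborel (\<lambda>y. real N * norm (f (y + z) - f y))"
      "integrable lborel (\<lambda>y. d * (norm (f (y + z)))\<^sup>2)" "integrable lborel (\<lambda>y. (1 / d + 1) * ?J y)"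
      using f fz f2z(1)[of z] tail_integrable[of N] by auto
    then show ?thesis
      by (simp only: Bochner_Integration.integral_add Bochner_Integration.integrable_add integral_mult_right_zero f2z(2) tail_def)
  qed
  finally show ?thesis .
qed

lemma autocorr_continuous_0:
  assumes z: "z \<longlonglongrightarrow> 0"
  shows "(\<lambda>k. autocorr f (z k)) \<longlonglongrightarrow> autocorr f 0"
proof -
  let ?n = "LINT y|lborel. (norm (f y))\<^sup>2"
  have n: "?n \<ge> 0" by simp
  have "(\<lambda>k. norm (autocorr f (z k) - autocorr f 0)) \<longlonglongrightarrow> 0"
  proof (rule tendsto_le_approx)
    fix e :: real assume "e > 0"
    define r where "r = ?n + 1"
    have r: "r > 0" "?n \<le> r" using n unfolding r_def by linarith+
    \<comment> \<open>Half of the error \<open>e\<close> goes to the weight \<open>d\<close>, the other half to the tail, once \<open>N\<close> is large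
        depending on \<open>d\<close>.\<close>
    define d where "d = e / (2 * r)"
    have d: "d > 0"
      using \<open>e > 0\<close> r by (simp add: d_def)
    have "d * ?n \<le> d * r"
      using d r by (simp add: mult_left_mono)
    also have "\<dots> = e / 2"
      using r by (simp add: d_def)
    finally have dn: "d * ?n \<le> e / 2" .
    have "(\<lambda>N. (1 / d + 1) * tail N) \<longlonglongrightarrow> (1 / d + 1) * 0"
      by (intro tendsto_intros tail_tendsto)
    then have "eventually (\<lambda>N. (1 / d + 1) * tail N < e / 2) sequentially"
      using \<open>e > 0\<close> by (intro order_tendstoD(2)) auto
    then obtain N where N: "(1 / d + 1) * tail N < e / 2"
      by (auto simp: eventually_sequentially)
    have "(\<lambda>k. real N * (LINT y|lborel. norm (f (y + z k) - f y))) \<longlonglongrightarrow> real N * 0"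
      by (intro tendsto_mult_left translation_continuous_L1 f z)
    moreover have "norm (autocorr f (z k) - autocorr f 0)
        \<le> real N * (LINT y|lborel. norm (f (y + z k) - f y)) + e" for k
      using autocorr_diff_le[OF d, of "z k" N] dn N by linarith
    ultimately show "\<exists>b. b \<longlonglongrightarrow> 0 \<and> (\<forall>k. norm (autocorr f (z k) - autocorr f 0) \<le> b k + e)"
      unfolding mult_zero_right by blast
  qed simp
  then show ?thesis
    using LIM_zero_cancel tendsto_norm_zero_iff by blast
qed

end

lemma fourier_modulated_gauss:
  assumes "e > 0"
  shows "fourier (\<lambda>u. complex_of_real (gauss (e *\<^sub>R u)) * iexp (- (u \<bullet> y))) (x::real^'d)
    = complex_of_real (sqrt (2 * pi) ^ CARD('d) * (gauss ((x - y) /\<^sub>R e) / e ^ CARD('d)))"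
proof -
  have "fourier (\<lambda>u. complex_of_real (gauss (e *\<^sub>R u)) * iexp (- (u \<bullet> y))) x
      = (LINT u|lborel. iexp (u \<bullet> (x - y)) * complex_of_real (gauss (e *\<^sub>R u)))"
    unfolding fourier_def
    by (intro Bochner_Integration.integral_cong refl)
       (simp add: inner_diff_right inner_commute[of x] exp_diff exp_minus field_simps)
  also have "\<dots> = (1 / e ^ CARD('d)) *\<^sub>R (LINT u|lborel. iexp ((u /\<^sub>R e) \<bullet> (x - y)) * complex_of_real (gauss u))"
    using assms integral_lborel_affine[of "\<lambda>u::real^'d. iexp (u \<bullet> (x - y)) * complex_of_real (gauss (e *\<^sub>R u))" "1 / e" 0]
    by (simp add: power_one_over divide_inverse power_inverse)
  also have "(LINT u|lborel. iexp ((u /\<^sub>R e) \<bullet> (x - y)) * complex_of_real (gauss u))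
      = fourier (\<lambda>u. complex_of_real (gauss u)) ((x - y) /\<^sub>R e)"
    unfolding fourier_def by (simp add: inner_commute)
  finally show ?thesis
    unfolding fourier_gauss by (simp add: scaleR_conv_of_real)
qed

lemma integrable_gauss_scale: "e \<noteq> 0 \<Longrightarrow> integrable lborel (\<lambda>x::'a::euclidean_space. gauss (e *\<^sub>R x))"
  using integrable_lborel_affine[OF integrable_gauss, of e 0] by simp

context
  fixes f :: "real^'d \<Rightarrow> complex"
  assumes f: "integrable lborel f" and f2: "integrable lborel (\<lambda>x. (norm (f x))\<^sup>2)"
begin

private lemma fm' [measurable]: "f \<in> borel_measurable borel"
  using f by auto

private lemma int_F:
  assumes "e \<noteq> 0"
  shows "integrable lborel (\<lambda>u. complex_of_real (gauss (e *\<^sub>R u)) * fourier f u)"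
    and "integrable lborel (\<lambda>u. (norm (fourier f u))\<^sup>2 * gauss (e *\<^sub>R u))"
proof -
  let ?C = "LINT x|lborel. norm (f x)"
  have C: "norm (fourier f u) \<le> \<bar>?C\<bar>" for u using norm_fourier_le[of f u] by simp
  show "integrable lborel (\<lambda>u. complex_of_real (gauss (e *\<^sub>R u)) * fourier f u)"
    by (rule Bochner_Integration.integrable_bound[of _ "\<lambda>u. gauss (e *\<^sub>R u) * ?C"])
       (use assms C in \<open>auto simp: norm_mult abs_mult intro!: integrable_gauss_scale mult_left_mono\<close>)
  have C2: "(norm (fourier f u))\<^sup>2 \<le> ?C\<^sup>2" for u
    using norm_fourier_le[of f u] by (intro power_mono) auto
  show "integrable lborel (\<lambda>u. (norm (fourier f u))\<^sup>2 * gauss (e *\<^sub>R u))"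
    by (rule Bochner_Integration.integrable_bound[of _ "\<lambda>u. ?C\<^sup>2 * gauss (e *\<^sub>R u)"])
       (use assms C2 in \<open>auto simp: abs_mult intro!: integrable_gauss_scale mult_right_mono\<close>)
qed

text \<open>
  Fourier inversion with a Gaussian damping factor: by the multiplication formula, damping the transform
  amounts to averaging \<open>f\<close> against a Gaussian of width \<open>e\<close>.
\<close>

lemma damped_inversion:
  assumes "e > 0"
  shows "fourier (\<lambda>u. complex_of_real (gauss (e *\<^sub>R u)) * fourier f u) (- y)
    = complex_of_real (sqrt (2 * pi) ^ CARD('d)) * (LINT z|lborel. f (y + e *\<^sub>R z) * complex_of_real (gauss z))"
proof -
  let ?c = "complex_of_real (sqrt (2 * pi) ^ CARD('d))"
  have "fourier (\<lambda>u. complex_of_real (gauss (e *\<^sub>R u)) * fourier f u) (- y)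
      = (LINT u|lborel. fourier f u * (complex_of_real (gauss (e *\<^sub>R u)) * iexp (- (u \<bullet> y))))"
    unfolding fourier_def[of _ "- y"] by (simp add: inner_commute mult_ac)
  also have "\<dots> = (LINT x|lborel. f x * complex_of_real (sqrt (2 * pi) ^ CARD('d) * (gauss ((x - y) /\<^sub>R e) / e ^ CARD('d))))"
  proof (subst fourier_multiplication_formula[OF f])
    show "integrable lborel (\<lambda>u. complex_of_real (gauss (e *\<^sub>R u)) * iexp (- (u \<bullet> y)))"
      by (rule Bochner_Integration.integrable_bound[OF integrable_gauss_scale[of e]])
         (use assms in \<open>auto simp: norm_mult\<close>)
  qed (simp only: fourier_modulated_gauss[OF assms])
  also have "\<dots> = e ^ CARD('d) *\<^sub>R (LINT z|lborel. f (y + e *\<^sub>R z) * complex_of_real (sqrt (2 * pi) ^ CARD('d) * (gauss z / e ^ CARD('d))))"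
    using assms integral_lborel_affine[of "\<lambda>x. f x * complex_of_real (sqrt (2 * pi) ^ CARD('d) * (gauss ((x - y) /\<^sub>R e) / e ^ CARD('d)))" e y]
    by simp
  also have "\<dots> = (LINT z|lborel. ?c * (f (y + e *\<^sub>R z) * complex_of_real (gauss z)))"
    unfolding integral_scaleR_right[symmetric]
    using assms by (intro Bochner_Integration.integral_cong refl) (simp add: scaleR_conv_of_real)
  finally show ?thesis by simp
qed

text \<open>
  Pairing the damped inversion formula with \<open>f\<close> itself gives a Gaussian average of the autocorrelation.
\<close>

lemma damped_plancherel:
  assumes "e > 0"
  shows "(LINT u|lborel. complex_of_real ((norm (fourier f u))\<^sup>2 * gauss (e *\<^sub>R u)))
    = complex_of_real (sqrt (2 * pi) ^ CARD('d)) * (LINT z|lborel. complex_of_real (gauss z) * autocorr f (e *\<^sub>R z))"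
proof -
  let ?c = "complex_of_real (sqrt (2 * pi) ^ CARD('d))"
  let ?k = "\<lambda>y z. cnj (f y) * (f (y + e *\<^sub>R z) * complex_of_real (gauss z))"
  have "(LINT u|lborel. complex_of_real ((norm (fourier f u))\<^sup>2 * gauss (e *\<^sub>R u)))
      = (LINT u|lborel. cnj (fourier f u) * (complex_of_real (gauss (e *\<^sub>R u)) * fourier f u))"
    by (simp only: of_real_mult complex_norm_square mult_ac)
  also have "\<dots> = (LINT y|lborel. cnj (f y) * (?c * (LINT z|lborel. f (y + e *\<^sub>R z) * complex_of_real (gauss z))))"
    using assms by (subst fourier_adjoint[OF f int_F(1)]) (auto simp only: damped_inversion)
  also have "\<dots> = (LINT y|lborel. ?c * (LINT z|lborel. ?k y z))"
    by (simp add: mult_ac)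
  also have "\<dots> = ?c * (LINT y|lborel. (LINT z|lborel. ?k y z))"
    by simp
  also have "(LINT y|lborel. (LINT z|lborel. ?k y z)) = (LINT z|lborel. (LINT y|lborel. ?k y z))"
  proof (rule lborel_pair.Fubini_integral)
    show "integrable (lborel \<Otimes>\<^sub>M lborel) (\<lambda>(z, y). ?k y z)"
    proof (rule lborel_pair.Fubini_integrable)
      have eq: "(LINT y|lborel. norm (case (z, y) of (z, y) \<Rightarrow> ?k y z))
          = gauss z * (LINT y|lborel. norm (f (y + e *\<^sub>R z) * cnj (f y)))" for z
        by (subst integral_mult_right_zero[symmetric]) (simp add: norm_mult mult_ac)
      show "integrable lborel (\<lambda>z. LINT y|lborel. norm (case (z, y) of (z, y) \<Rightarrow> ?k y z))"
        unfolding eq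
        by (rule Bochner_Integration.integrable_bound[of _ "\<lambda>z. gauss z * (LINT y|lborel. (norm (f y))\<^sup>2)"])
           (auto simp: integrable_gauss abs_mult intro!: mult_left_mono integral_norm_autocorr_le f f2)
      show "AE z in lborel. integrable lborel (\<lambda>y. case (z, y) of (z, y) \<Rightarrow> ?k y z)"
      proof (rule AE_I2)
        fix z
        have "integrable lborel (\<lambda>y. complex_of_real (gauss z) * (f (y + e *\<^sub>R z) * cnj (f y)))"
          by (intro integrable_mult_right integrable_autocorr f f2)
        then show "integrable lborel (\<lambda>y. case (z, y) of (z, y) \<Rightarrow> ?k y z)"
          by (simp add: mult_ac)
      qed
    qed measurable
  qed
  also have "\<dots> = (LINT z|lborel. complex_of_real (gauss z) * autocorr f (e *\<^sub>R z))"
    unfolding autocorr_def by (subst integral_mult_right_zero[symmetric]) (simp add: mult_ac)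
  finally show ?thesis .
qed

text \<open>
  As \<open>e\<close> tends to \<open>0\<close>, the left-hand side of the damped identity increases to the integral of the squared
  modulus of \<open>fourier f\<close> by monotone convergence, which yields integrability as well. On the right-hand
  side the autocorrelation is evaluated near \<open>0\<close>, where it is continuous. The two factors
  \<open>sqrt (2 * pi) ^ d\<close> come from the transform and from the total mass of the Gaussian.
\<close>

theorem plancherel:
  "has_bochner_integral lborel (\<lambda>u. (norm (fourier f u))\<^sup>2) ((2 * pi) ^ CARD('d) * (LINT x|lborel. (norm (f x))\<^sup>2))"
proof -
  let ?N = "LINT x|lborel. (norm (f x))\<^sup>2"
  let ?c = "complex_of_real (sqrt (2 * pi) ^ CARD('d))"
  define e where "e k = 1 / real (Suc k)" for k
  have e: "e k > 0" "e \<longlonglongrightarrow> 0" for k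
    using LIMSEQ_Suc[OF lim_1_over_n] by (auto simp: e_def[abs_def])
  let ?h = "\<lambda>k u. (norm (fourier f u))\<^sup>2 * gauss (e k *\<^sub>R u)"
  have "(\<lambda>k. LINT z|lborel. complex_of_real (gauss z) * autocorr f (e k *\<^sub>R z))
      \<longlonglongrightarrow> (LINT z|lborel. complex_of_real (gauss (z::real^'d)) * autocorr f 0)"
  proof (rule integral_dominated_convergence[where w="\<lambda>z::real^'d. gauss z * ?N"])
    show "AE z in lborel. (\<lambda>k. complex_of_real (gauss z) * autocorr f (e k *\<^sub>R z))
        \<longlonglongrightarrow> complex_of_real (gauss z) * autocorr f 0"
    proof (rule AE_I2)
      fix z :: "real^'d"
      have "(\<lambda>k. e k *\<^sub>R z) \<longlonglongrightarrow> 0"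
        using tendsto_scaleR[OF e(2) tendsto_const[of z]] by simp
      then show "(\<lambda>k. complex_of_real (gauss z) * autocorr f (e k *\<^sub>R z))
          \<longlonglongrightarrow> complex_of_real (gauss z) * autocorr f 0"
        by (intro tendsto_mult_left autocorr_continuous_0 f f2)
    qed
    show "AE z in lborel. norm (complex_of_real (gauss z) * autocorr f (e k *\<^sub>R z)) \<le> gauss z * ?N" for k
      using norm_autocorr_le[OF f f2] by (auto simp: norm_mult intro!: mult_left_mono)
  qed (auto simp: integrable_gauss)
  then have "(\<lambda>k. ?c * (LINT z|lborel. complex_of_real (gauss z) * autocorr f (e k *\<^sub>R z)))
      \<longlonglongrightarrow> ?c * (LINT z|lborel. complex_of_real (gauss (z::real^'d)) * autocorr f 0)"
    by (rule tendsto_mult_left)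
  also have "(\<lambda>k. ?c * (LINT z|lborel. complex_of_real (gauss z) * autocorr f (e k *\<^sub>R z)))
      = (\<lambda>k. complex_of_real (LINT u|lborel. ?h k u))"
    using e(1) by (simp only: damped_plancherel[symmetric] integral_complex_of_real)
  also have "?c * (LINT z|lborel. complex_of_real (gauss (z::real^'d)) * autocorr f 0)
      = complex_of_real ((2 * pi) ^ CARD('d) * ?N)"
  proof -
    have "?c * (LINT z|lborel. complex_of_real (gauss (z::real^'d)) * autocorr f 0)
        = ?c * (complex_of_real (LINT z|lborel. gauss (z::real^'d)) * complex_of_real ?N)"
      using autocorr_0[OF f f2] by (simp only: integral_mult_left_zero integral_complex_of_real)
    also have "\<dots> = complex_of_real ((sqrt (2 * pi) ^ CARD('d) * sqrt (2 * pi) ^ CARD('d)) * ?N)"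
      unfolding integral_gauss by (simp only: of_real_mult mult.assoc)
    also have "sqrt (2 * pi) ^ CARD('d) * sqrt (2 * pi) ^ CARD('d) = (2 * pi) ^ CARD('d)"
      unfolding power_mult_distrib[symmetric] real_sqrt_mult_self by simp
    finally show ?thesis .
  qed
  finally have lim: "(\<lambda>k. LINT u|lborel. ?h k u) \<longlonglongrightarrow> (2 * pi) ^ CARD('d) * ?N"
    by (simp only: tendsto_of_real_iff)
  have int: "integrable lborel (?h k)" for k
    using e(1)[of k] by (intro int_F) simp
  have mono: "AE u in lborel. mono (\<lambda>k. ?h k u)"
    proof (rule AE_I2, rule monoI)
      fix u :: "real^'d" and j k :: nat assume "j \<le> k"
      then have "e k \<le> e j" by (simp add: e_def frac_le)
      then have "(e k)\<^sup>2 \<le> (e j)\<^sup>2" using e(1)[of k] by (intro power_mono) auto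
      then have "gauss (e j *\<^sub>R u) \<le> gauss (e k *\<^sub>R u)"
        by (simp add: gauss_def power2_eq_square mult.assoc[symmetric] mult_right_mono)
      then show "?h j u \<le> ?h k u" by (intro mult_left_mono) auto
    qed
  have ptw: "AE u in lborel. (\<lambda>k. ?h k u) \<longlonglongrightarrow> (norm (fourier f u))\<^sup>2"
    proof (rule AE_I2)
      fix u :: "real^'d"
      have "(\<lambda>k. gauss (e k *\<^sub>R u)) \<longlonglongrightarrow> gauss (0 *\<^sub>R u)"
        unfolding gauss_def by (intro tendsto_intros e(2)) simp
      then have "(\<lambda>k. ?h k u) \<longlonglongrightarrow> (norm (fourier f u))\<^sup>2 * gauss (0 *\<^sub>R u)"
        by (rule tendsto_mult_left)
      then show "(\<lambda>k. ?h k u) \<longlonglongrightarrow> (norm (fourier f u))\<^sup>2" by simp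
    qed
  have "AE u in lborel. 0 \<le> ?h k u" for k by simp
  from integral_monotone_convergence_nonneg[OF int mono this ptw lim] show ?thesis
    by (simp add: has_bochner_integral_iff)
qed

end

section \<open>Volume of linear images\<close>

lemma linear_shear: "linear (\<lambda>x::real^'n. \<chi> i. if i = m then x $ m + x $ n else x $ i)"
  by (rule linearI) (auto simp: vec_eq_iff algebra_simps)

lemma linear_swap: "linear (\<lambda>x::real^'n. \<chi> i. x $ Transposition.transpose m n i)"
  by (rule linearI) (auto simp: vec_eq_iff)

lemma det_matrix_shear:
  assumes "m \<noteq> n"
  shows "det (matrix (\<lambda>x::real^'n. \<chi> i. if i = m then x $ m + x $ n else x $ i)) = 1"
proof -
  have "matrix (\<lambda>x::real^'n. \<chi> i. if i = m then x $ m + x $ n else x $ i)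
      = (\<chi> k. if k = m then row m (mat 1) + 1 *s row n (mat 1) else row k (mat 1))"
    by (auto simp: vec_eq_iff matrix_def row_def mat_def axis_def)
  then show ?thesis
    using det_row_operation[OF assms, of "mat 1 :: real^'n^'n" 1] by simp
qed

lemma abs_det_matrix_swap:
  "\<bar>det (matrix (\<lambda>x::real^'n. \<chi> i. x $ Transposition.transpose m n i))\<bar> = 1" (is "\<bar>det (matrix ?h)\<bar> = 1")
proof -
  have "?h \<circ> ?h = id" by (auto simp: vec_eq_iff)
  then have "matrix ?h ** matrix ?h = mat 1"
    using matrix_compose[OF linear_swap linear_swap, of m n m n] by (simp add: matrix_id_mat_1)
  then have "det (matrix ?h ** matrix ?h) = 1"
    by (simp only: det_I)
  then have "(det (matrix ?h))\<^sup>2 = 1"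
    by (simp add: det_mul power2_eq_square)
  then show ?thesis
    by (auto simp: power2_eq_1_iff)
qed

lemma measure_shear_cbox:
  assumes "m \<noteq> n"
  shows "measure lebesgue ((\<lambda>x::real^'n. \<chi> i. if i = m then x $ m + x $ n else x $ i) ` cbox a b)
    = measure lebesgue (cbox a b)" (is "measure lebesgue (?h ` _) = _")
proof (cases "cbox a b = {}")
  case False
  \<comment> \<open>Translation to the origin meets the sign condition in \<open>measure_shear_interval\<close>.\<close>
  have im: "cbox a b = (+) a ` cbox 0 (b - a)"
    using cbox_translation[of a 0 "b - a"] by simp
  have "?h (a + x) = ?h a + ?h x" for x
    by (rule linear_add[OF linear_shear])
  then have "?h ` cbox a b = (+) (?h a) ` ?h ` cbox 0 (b - a)"
    unfolding im by (simp add: image_image)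
  then have "measure lebesgue (?h ` cbox a b) = measure lebesgue (?h ` cbox 0 (b - a))"
    by (simp only: measure_translation)
  also have "\<dots> = measure lebesgue (cbox 0 (b - a))"
    using False unfolding im by (intro measure_shear_interval assms) auto
  also have "\<dots> = measure lebesgue (cbox a b)"
    unfolding im measure_translation ..
  finally show ?thesis .
qed simp

lemma measure_swap_cbox:
  "measure lebesgue ((\<lambda>x::real^'n. \<chi> i. x $ Transposition.transpose m n i) ` cbox a b) = measure lebesgue (cbox a b)"
  (is "measure lebesgue (?h ` _) = _")
proof (cases "cbox a b = {}")
  case False
  have inv: "?h (?h x) = x" for x by (simp add: vec_eq_iff)
  have sub: "?h ` cbox c d \<subseteq> cbox (?h c) (?h d)" for c d
    by (auto simp: mem_box_cart)
  have im: "?h ` cbox a b = cbox (?h a) (?h b)"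
  proof (rule antisym[OF sub])
    have "?h ` cbox (?h a) (?h b) \<subseteq> cbox a b"
      using sub[of "?h a" "?h b"] unfolding inv .
    then have "?h ` ?h ` cbox (?h a) (?h b) \<subseteq> ?h ` cbox a b" by (rule image_mono)
    then show "cbox (?h a) (?h b) \<subseteq> ?h ` cbox a b" unfolding image_image inv by simp
  qed
  have "(\<Prod>i\<in>UNIV. ?h b $ i - ?h a $ i) = (\<Prod>i\<in>UNIV. b $ i - a $ i)"
    using prod.permute[OF permutes_swap_id[of m UNIV n], of "\<lambda>i. b $ i - a $ i"] by (simp add: comp_def)
  moreover have "cbox (?h a) (?h b) \<noteq> {}"
    using False unfolding im[symmetric] by simp
  ultimately show ?thesis
    unfolding im using False by (simp add: content_cbox_cart del: image_is_empty)
qed simp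

text \<open>
  Induction over elementary linear maps. The determinant of a shear comes from a row operation on the
  identity matrix and that of a transposition from its being an involution, so the index type carries no order.
\<close>

lemma measure_linear_image_finite:
  fixes f :: "real^'n \<Rightarrow> real^'n"
  assumes "linear f" "S \<in> lmeasurable"
  shows "f ` S \<in> lmeasurable \<and> measure lebesgue (f ` S) = \<bar>det (matrix f)\<bar> * measure lebesgue S"
proof -
  let ?P = "\<lambda>f::real^'n \<Rightarrow> real^'n. \<forall>S\<in>lmeasurable.
    f ` S \<in> lmeasurable \<and> measure lebesgue (f ` S) = \<bar>det (matrix f)\<bar> * measure lebesgue S"
  have "?P f"
  proof (rule induct_linear_elementary[OF assms(1)])
    fix f g :: "real^'n \<Rightarrow> real^'n" assume fg: "linear f" "linear g" "?P f" "?P g"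
    show "?P (f \<circ> g)"
    proof
      fix S :: "(real^'n) set" assume S: "S \<in> lmeasurable"
      have "(f \<circ> g) ` S = f ` (g ` S)" by (rule image_comp[symmetric])
      moreover have "matrix (f \<circ> g) = matrix f ** matrix g" by (rule matrix_compose[OF fg(2,1)])
      ultimately show "(f \<circ> g) ` S \<in> lmeasurable \<and>
          measure lebesgue ((f \<circ> g) ` S) = \<bar>det (matrix (f \<circ> g))\<bar> * measure lebesgue S"
        using fg(3)[rule_format, of "g ` S"] fg(4)[rule_format, OF S]
        by (simp only: det_mul abs_mult mult.assoc simp_thms)
    qed
  next
    fix f :: "real^'n \<Rightarrow> real^'n" and i assume "linear f" and "\<And>x. f x $ i = 0"
    then have "\<not> inj f"
      by (metis linear_injective_imp_surjective one_neq_zero surjE vec_component)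
    then have "det (matrix f) = 0" "negligible (f ` S)" for S
      using det_nz_iff_inj[OF \<open>linear f\<close>] negligible_linear_singular_image[OF \<open>linear f\<close>] by auto
    then show "?P f"
      by (auto simp: negligible_imp_measure0 negligible_imp_measurable)
  next
    fix c :: "'n \<Rightarrow> real"
    show "?P (\<lambda>x. \<chi> i. c i * x $ i)"
      using measurable_stretch measure_stretch by (auto simp: matrix_def axis_def det_diagonal)
  next
    fix m n :: 'n
    let ?h = "\<lambda>x::real^'n. \<chi> i. x $ Transposition.transpose m n i"
    show "?P ?h"
    proof
      fix S :: "(real^'n) set" assume "S \<in> lmeasurable"
      from measure_linear_sufficient[OF linear_swap[of m n] this, where m=1]
      show "?h ` S \<in> lmeasurable \<and> measure lebesgue (?h ` S) = \<bar>det (matrix ?h)\<bar> * measure lebesgue S"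
        unfolding abs_det_matrix_swap measure_swap_cbox by simp
    qed
  next
    fix m n :: 'n assume "m \<noteq> n"
    let ?h = "\<lambda>x::real^'n. \<chi> i. if i = m then x $ m + x $ n else x $ i"
    show "?P ?h"
    proof
      fix S :: "(real^'n) set" assume "S \<in> lmeasurable"
      from measure_linear_sufficient[OF linear_shear[of m n] this, where m=1]
      show "?h ` S \<in> lmeasurable \<and> measure lebesgue (?h ` S) = \<bar>det (matrix ?h)\<bar> * measure lebesgue S"
        unfolding det_matrix_shear[OF \<open>m \<noteq> n\<close>] measure_shear_cbox[OF \<open>m \<noteq> n\<close>] by simp
    qed
  qed
  then show ?thesis using assms(2) by blast
qed

lemma compact_matrix_sym_box: "compact ((*v) (A :: real^'d^'d) ` sym_box m)"
  unfolding sym_box_def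
  by (intro compact_continuous_image compact_cbox linear_continuous_on matrix_vector_mul_bounded_linear)

lemma emeasure_matrix_sym_box:
  fixes A :: "real^'d^'d"
  assumes "\<And>i. 0 \<le> m $ i"
  shows "emeasure lborel ((*v) A ` sym_box m) = ennreal (\<bar>det A\<bar> * (2 ^ CARD('d) * (\<Prod>i\<in>UNIV. m $ i)))"
proof -
  let ?S = "(*v) A ` sym_box m"
  have cS: "compact ?S" by (rule compact_matrix_sym_box)
  then have S: "?S \<in> sets borel" by (simp add: borel_compact)
  have vol: "measure lebesgue (sym_box m) = 2 ^ CARD('d) * (\<Prod>i\<in>UNIV. m $ i)"
  proof -
    have "\<And>i. - m $ i \<le> m $ i" using assms by (smt (verit))
    then have "cbox (- m) m \<noteq> {}" by (simp add: interval_ne_empty_cart)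
    then show ?thesis
      unfolding sym_box_def by (simp add: content_cbox_cart prod.distrib flip: mult_2)
  qed
  have "emeasure lborel ?S = ennreal (measure lborel ?S)"
    using emeasure_compact_finite[OF cS] by (intro emeasure_eq_ennreal_measure) auto
  also have "measure lborel ?S = measure lebesgue ?S"
    using S by simp
  also have "\<dots> = \<bar>det A\<bar> * measure lebesgue (sym_box m)"
    using measure_linear_image_finite[OF matrix_vector_mul_linear, of "sym_box m" A]
    by (simp add: sym_box_def)
  finally show ?thesis unfolding vol .
qed

lemma matrix_class_image_subset:
  fixes A :: "real^'d^'d"
  assumes A: "A \<in> matrix_class" and m: "m \<in> cbox 0 (\<chi> i. r)" and r: "r > 0"
  shows "(*v) A ` sym_box m \<subseteq> sym_box (\<chi> i. r)"
proof (rule image_subsetI)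
  fix x assume x: "x \<in> sym_box m"
  have "(1 / r) *\<^sub>R x \<in> sym_box (\<chi> i. 1)"
  proof -
    have "\<bar>x $ i\<bar> \<le> r" for i
      using x m unfolding sym_box_def mem_box_cart by (auto simp: abs_le_iff) (smt (verit))+
    then show ?thesis
      using r unfolding sym_box_def mem_box_cart by (auto simp: abs_le_iff field_simps) (smt (verit))+
  qed
  then have "A *v ((1 / r) *\<^sub>R x) \<in> sym_box (\<chi> i. 1)"
    using A unfolding matrix_class_def by blast
  then have "(1 / r) *\<^sub>R (A *v x) \<in> sym_box (\<chi> i. 1)"
    by (simp add: matrix_vector_mult_scaleR)
  then show "A *v x \<in> sym_box (\<chi> i. r)"
    using r unfolding sym_box_def mem_box_cart by (auto simp: field_simps)
qed

section \<open>Square-integrable functions and the spectral cut-off\<close>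

lemma is_L2_iff: "is_L2 g \<longleftrightarrow> g \<in> borel_measurable borel \<and> integrable lborel (\<lambda>x. (norm (g x))\<^sup>2)"
proof -
  have "(\<lambda>x. (norm (g x))\<^sup>2) \<in> borel_measurable borel" if "g \<in> borel_measurable borel"
    using that by measurable
  then show ?thesis
    unfolding is_L2_def L2_norm_sq_def integrable_iff_bounded by (auto simp: less_top)
qed

lemma is_L2D:
  assumes "is_L2 g"
  shows "g \<in> borel_measurable borel" "integrable lborel (\<lambda>x. (norm (g x))\<^sup>2)"
  using assms by (auto simp: is_L2_iff)

lemma L2_norm_sq_eq_integral:
  assumes "is_L2 g"
  shows "L2_norm_sq g = ennreal (LINT x|lborel. (norm (g x))\<^sup>2)"
  unfolding L2_norm_sq_def using is_L2D(2)[OF assms] by (intro nn_integral_eq_integral) auto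

lemma
  assumes a: "is_L2 a" and b: "is_L2 b"
  shows is_L2_diff: "is_L2 (\<lambda>x. a x - b x)"
    and integral_norm_diff_sq: "(LINT x|lborel. (norm (a x - b x))\<^sup>2)
      = (LINT x|lborel. (norm (a x))\<^sup>2) + (LINT x|lborel. (norm (b x))\<^sup>2) - 2 * Re (LINT x|lborel. cnj (b x) * a x)"
proof -
  note [measurable] = is_L2D(1)[OF a] is_L2D(1)[OF b]
  have cross: "integrable lborel (\<lambda>x. cnj (b x) * a x)"
  proof (rule Bochner_Integration.integrable_bound)
    show "integrable lborel (\<lambda>x. ((norm (a x))\<^sup>2 + (norm (b x))\<^sup>2) / 2)"
      using is_L2D(2)[OF a] is_L2D(2)[OF b] by simp
    show "AE x in lborel. norm (cnj (b x) * a x) \<le> norm (((norm (a x))\<^sup>2 + (norm (b x))\<^sup>2) / 2)"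
    proof (rule AE_I2)
      fix x show "norm (cnj (b x) * a x) \<le> norm (((norm (a x))\<^sup>2 + (norm (b x))\<^sup>2) / 2)"
        using norm_mult_cnj_le[of "a x" "b x"] by (simp add: mult.commute)
    qed
  qed measurable
  have eq: "(norm (a x - b x))\<^sup>2 = ((norm (a x))\<^sup>2 + (norm (b x))\<^sup>2) - 2 * Re (cnj (b x) * a x)" for x
    unfolding cmod_power2 by (simp add: power2_eq_square algebra_simps)
  have int: "integrable lborel (\<lambda>x. (norm (a x))\<^sup>2 + (norm (b x))\<^sup>2)" "integrable lborel (\<lambda>x. 2 * Re (cnj (b x) * a x))"
    by (intro Bochner_Integration.integrable_add is_L2D a b, intro integrable_mult_right integrable_Re cross)
  show "is_L2 (\<lambda>x. a x - b x)"
    unfolding is_L2_iff eq using int by (intro conjI Bochner_Integration.integrable_diff) auto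
  show "(LINT x|lborel. (norm (a x - b x))\<^sup>2)
      = (LINT x|lborel. (norm (a x))\<^sup>2) + (LINT x|lborel. (norm (b x))\<^sup>2) - 2 * Re (LINT x|lborel. cnj (b x) * a x)"
    unfolding eq Bochner_Integration.integral_diff[OF int]
    unfolding Bochner_Integration.integral_add[OF is_L2D(2)[OF a] is_L2D(2)[OF b]] integral_mult_right_zero
      integral_Re[OF cross] ..
qed

text \<open>
  A substitute for the triangle inequality that stays with squared norms; letting \<open>d\<close> tend to \<open>0\<close>
  recovers continuity of the squared norm under \<open>L\<^sup>2\<close> limits.
\<close>

lemma L2_norm_sq_triangle:
  assumes [measurable]: "a \<in> borel_measurable borel" "b \<in> borel_measurable borel" "c \<in> borel_measurable borel"
    and "d > 0"
  shows "L2_norm_sq (\<lambda>x. a x - c x)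
    \<le> ennreal (1 + d) * L2_norm_sq (\<lambda>x. a x - b x) + ennreal (1 + 1 / d) * L2_norm_sq (\<lambda>x. b x - c x)"
proof -
  have "(norm (u + v))\<^sup>2 \<le> (1 + d) * (norm u)\<^sup>2 + (1 + 1 / d) * (norm v)\<^sup>2" for u v :: complex
  proof -
    have "(norm (u + v))\<^sup>2 \<le> (norm u + norm v)\<^sup>2"
      by (intro power_mono norm_triangle_ineq) simp
    also have "\<dots> = (norm u)\<^sup>2 + (norm v)\<^sup>2 + 2 * norm u * norm v"
      by (simp add: power2_sum)
    also have "2 * norm u * norm v \<le> d * (norm u)\<^sup>2 + 1 / d * (norm v)\<^sup>2"
    proof -
      have "0 \<le> (sqrt d * norm u - sqrt (1 / d) * norm v)\<^sup>2" by simp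
      also have "\<dots> = d * (norm u)\<^sup>2 + 1 / d * (norm v)\<^sup>2 - 2 * (sqrt d * sqrt (1 / d)) * norm u * norm v"
        using \<open>d > 0\<close> by (simp add: power2_diff power_mult_distrib real_sqrt_divide power_divide)
      also have "sqrt d * sqrt (1 / d) = 1"
        using \<open>d > 0\<close> by (simp flip: real_sqrt_mult)
      finally show ?thesis by simp
    qed
    finally show ?thesis by (simp add: algebra_simps)
  qed
  from this[of "a x - b x" "b x - c x" for x]
  have "L2_norm_sq (\<lambda>x. a x - c x)
      \<le> (\<integral>\<^sup>+x. ennreal ((1 + d) * (norm (a x - b x))\<^sup>2 + (1 + 1 / d) * (norm (b x - c x))\<^sup>2) \<partial>lborel)"
    unfolding L2_norm_sq_def by (intro nn_integral_mono ennreal_leI) simp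
  also have "\<dots> = (\<integral>\<^sup>+x. ennreal (1 + d) * ennreal ((norm (a x - b x))\<^sup>2)
      + ennreal (1 + 1 / d) * ennreal ((norm (b x - c x))\<^sup>2) \<partial>lborel)"
  proof (intro nn_integral_cong)
    fix x
    have nn: "0 \<le> (1 + d) * (norm (a x - b x))\<^sup>2" "0 \<le> (1 + 1 / d) * (norm (b x - c x))\<^sup>2"
      using \<open>d > 0\<close> by simp_all
    show "ennreal ((1 + d) * (norm (a x - b x))\<^sup>2 + (1 + 1 / d) * (norm (b x - c x))\<^sup>2)
        = ennreal (1 + d) * ennreal ((norm (a x - b x))\<^sup>2) + ennreal (1 + 1 / d) * ennreal ((norm (b x - c x))\<^sup>2)"
      unfolding ennreal_plus[OF nn] using \<open>d > 0\<close> by (subst (1 2) ennreal_mult) auto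
  qed
  also have "\<dots> = ennreal (1 + d) * L2_norm_sq (\<lambda>x. a x - b x) + ennreal (1 + 1 / d) * L2_norm_sq (\<lambda>x. b x - c x)"
    unfolding L2_norm_sq_def
    by (subst nn_integral_add; (subst nn_integral_cmult)?) (measurable, simp add: nn_integral_cmult)
  finally show ?thesis .
qed

lemma L2_norm_sq_minus_commute: "L2_norm_sq (\<lambda>x. a x - b x) = L2_norm_sq (\<lambda>x. b x - a x)"
  unfolding L2_norm_sq_def by (simp add: norm_minus_commute)

definition fourier_inv :: "(real^'d \<Rightarrow> complex) \<Rightarrow> real^'d \<Rightarrow> complex" where
  "fourier_inv h x = 1 / (2 * of_real pi) ^ CARD('d) * fourier h (- x)"

lemma plancherel_L2:
  assumes "integrable lborel f" "is_L2 f"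
  shows "is_L2 (fourier f)"
    and "(LINT u|lborel. (norm (fourier (f :: real^'d \<Rightarrow> complex) u))\<^sup>2) = (2 * pi) ^ CARD('d) * (LINT x|lborel. (norm (f x))\<^sup>2)"
  using plancherel[OF assms(1) is_L2D(2)[OF assms(2)]] is_L2D(1)[OF assms(2)]
  by (auto simp: has_bochner_integral_iff is_L2_iff)

lemma norm_fourier_inv_sq:
  "(norm (fourier_inv h (x::real^'d)))\<^sup>2 = (norm (fourier h (- x)))\<^sup>2 / ((2 * pi) ^ CARD('d))\<^sup>2"
  unfolding fourier_inv_def by (simp add: norm_mult norm_divide norm_power power_divide)

lemma fourier_inv_L2:
  fixes h :: "real^'d \<Rightarrow> complex"
  assumes "integrable lborel h" "is_L2 h"
  shows "is_L2 (fourier_inv h)"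
    and "(LINT x|lborel. (norm (fourier_inv h x))\<^sup>2) = (LINT u|lborel. (norm (h u))\<^sup>2) / (2 * pi) ^ CARD('d)"
proof -
  note [measurable] = is_L2D(1)[OF assms(2)]
  note F = plancherel_L2[OF assms]
  have m: "fourier_inv h \<in> borel_measurable borel"
    unfolding fourier_inv_def[abs_def] by measurable
  show "is_L2 (fourier_inv h)"
    unfolding is_L2_iff norm_fourier_inv_sq
    using m integrable_reflect[OF is_L2D(2)[OF F(1)]] by simp
  have "(LINT x|lborel. (norm (fourier_inv h x))\<^sup>2)
      = (LINT x|lborel. (norm (fourier h (- x)))\<^sup>2) / ((2 * pi) ^ CARD('d))\<^sup>2"
    unfolding norm_fourier_inv_sq by simp
  also have "(LINT x|lborel. (norm (fourier h (- x)))\<^sup>2) = (LINT x|lborel. (norm (fourier h x))\<^sup>2)"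
    using integral_lborel_affine[of "\<lambda>x::real^'d. (norm (fourier h x))\<^sup>2" "-1" 0] by simp
  finally show "(LINT x|lborel. (norm (fourier_inv h x))\<^sup>2) = (LINT u|lborel. (norm (h u))\<^sup>2) / (2 * pi) ^ CARD('d)"
    unfolding F(2) by (simp add: power2_eq_square)
qed

text \<open>
  The form of Plancherel's theorem that compares an inverse transform with a function whose own Fourier
  inversion integral may diverge. Both squared distances are expanded: the square terms agree by
  \<open>plancherel\<close>, the cross terms by \<open>fourier_adjoint\<close>.
\<close>

theorem plancherel_mixed:
  fixes f h :: "real^'d \<Rightarrow> complex"
  assumes f: "integrable lborel f" "is_L2 f" and h: "integrable lborel h" "is_L2 h"
  shows "L2_norm_sq (\<lambda>x. fourier_inv h x - f x)
    = ennreal (1 / (2 * pi) ^ CARD('d)) * L2_norm_sq (\<lambda>u. h u - fourier f u)"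
proof -
  let ?K = "(2 * pi) ^ CARD('d)"
  note F = plancherel_L2[OF f] and H = fourier_inv_L2[OF h]
  have "(LINT x|lborel. cnj (f x) * fourier_inv h x)
      = 1 / (2 * of_real pi) ^ CARD('d) * (LINT x|lborel. cnj (f x) * fourier h (- x))"
    unfolding fourier_inv_def by (subst integral_mult_right_zero[symmetric]) (simp add: mult_ac)
  also have "\<dots> = of_real (1 / ?K) * (LINT u|lborel. cnj (fourier f u) * h u)"
    unfolding fourier_adjoint[OF f(1) h(1)] by simp
  finally have "(LINT x|lborel. cnj (f x) * fourier_inv h x)
      = of_real (1 / ?K) * (LINT u|lborel. cnj (fourier f u) * h u)" .
  then have cross: "Re (LINT x|lborel. cnj (f x) * fourier_inv h x)
      = Re (LINT u|lborel. cnj (fourier f u) * h u) / ?K"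
    by (simp only: times_complex.sel Re_complex_of_real Im_complex_of_real) simp
  have "(LINT x|lborel. (norm (fourier_inv h x - f x))\<^sup>2) = 1 / ?K * (LINT u|lborel. (norm (h u - fourier f u))\<^sup>2)"
    unfolding integral_norm_diff_sq[OF H(1) f(2)] integral_norm_diff_sq[OF h(2) F(1)] H(2) F(2) cross
    by (simp add: field_simps)
  then show ?thesis
    unfolding L2_norm_sq_eq_integral[OF is_L2_diff[OF H(1) f(2)]] L2_norm_sq_eq_integral[OF is_L2_diff[OF h(2) F(1)]]
    by (simp flip: ennreal_mult)
qed

lemma plancherel_diff:
  fixes f g :: "real^'d \<Rightarrow> complex"
  assumes f: "integrable lborel f" "is_L2 f" and g: "integrable lborel g" "is_L2 g"
  shows "L2_norm_sq (\<lambda>u. fourier f u - fourier g u) = ennreal ((2 * pi) ^ CARD('d)) * L2_norm_sq (\<lambda>x. f x - g x)"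
proof -
  note d = Bochner_Integration.integrable_diff[OF f(1) g(1)] is_L2_diff[OF f(2) g(2)]
  have "fourier (\<lambda>x. f x - g x) = (\<lambda>u. fourier f u - fourier g u)"
    by (rule ext) (rule fourier_diff[OF f(1) g(1)])
  then have "L2_norm_sq (\<lambda>u. fourier f u - fourier g u) = L2_norm_sq (fourier (\<lambda>x. f x - g x))"
    by simp
  also have "\<dots> = ennreal ((2 * pi) ^ CARD('d)) * L2_norm_sq (\<lambda>x. f x - g x)"
    unfolding L2_norm_sq_eq_integral[OF plancherel_L2(1)[OF d]] L2_norm_sq_eq_integral[OF d(2)] plancherel_L2(2)[OF d]
    by (simp add: ennreal_mult)
  finally show ?thesis .
qed

text \<open>
  The inverse transform of \<open>h\<close> need not be integrable, so it is approximated by its restrictions to balls.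
  Their transforms converge to \<open>h\<close> because the mixed Plancherel identity turns the distance to \<open>h\<close> into
  the distance of the restrictions to the inverse transform.
\<close>

lemma has_L2_fourier_inv:
  fixes h :: "real^'d \<Rightarrow> complex"
  assumes h: "integrable lborel h" "is_L2 h"
  shows "has_L2_fourier (fourier_inv h) h"
proof -
  let ?g = "fourier_inv h" and ?K = "(2 * pi) ^ CARD('d)"
  note g = fourier_inv_L2(1)[OF h]
  note [measurable] = is_L2D(1)[OF g] is_L2D(1)[OF h(2)]
  define G where "G = (\<lambda>(k::nat) x. ?g x * indicator (ball 0 (real k)) x)"
  have [measurable]: "ball (0::real^'d) r \<in> sets borel" for r by simp
  have Gm: "G k \<in> borel_measurable borel" for k
    unfolding G_def by measurable
  have G2: "is_L2 (G k)" for k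
    unfolding is_L2_iff
  proof (intro conjI Gm)
    show "integrable lborel (\<lambda>x. (norm (G k x))\<^sup>2)"
    proof (rule Bochner_Integration.integrable_bound[OF is_L2D(2)[OF g]])
      show "(\<lambda>x. (norm (G k x))\<^sup>2) \<in> borel_measurable lborel" using Gm[of k] by simp
      show "AE x in lborel. norm ((norm (G k x))\<^sup>2) \<le> norm ((norm (?g x))\<^sup>2)"
        by (rule AE_I2) (auto simp: G_def split: split_indicator)
    qed
  qed
  have G1: "integrable lborel (G k)" for k
  proof (rule Bochner_Integration.integrable_bound[of _ "\<lambda>x. (norm (?g x))\<^sup>2 + indicator (ball 0 (real k)) x"])
    \<comment> \<open>On a ball, of finite measure, \<open>a \<le> a\<^sup>2 + 1\<close> turns square integrability into integrability.\<close>
    show "integrable lborel (\<lambda>x. (norm (?g x))\<^sup>2 + indicator (ball 0 (real k)) x :: real)"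
      using is_L2D(2)[OF g] emeasure_lborel_ball_finite[of "0::real^'d" "real k"]
      by (intro Bochner_Integration.integrable_add) (auto simp: integrable_indicator_iff)
    show "AE x in lborel. norm (G k x) \<le> norm ((norm (?g x))\<^sup>2 + indicator (ball 0 (real k)) x)"
    proof (rule AE_I2)
      fix x
      have "norm (?g x) \<le> (norm (?g x))\<^sup>2 + 1"
        using sum_squares_bound[of "norm (?g x)" 1] norm_ge_zero[of "?g x"]
        unfolding mult_1_right one_power2 by linarith
      then show "norm (G k x) \<le> norm ((norm (?g x))\<^sup>2 + indicator (ball 0 (real k)) x)"
        by (auto simp: G_def split: split_indicator)
    qed
  qed (use Gm in simp)
  have conv: "(\<lambda>k. L2_norm_sq (\<lambda>x. G k x - ?g x)) \<longlonglongrightarrow> 0"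
  proof -
    have "(\<lambda>k. LINT x|lborel. (norm (G k x - ?g x))\<^sup>2) \<longlonglongrightarrow> (LINT x|(lborel::(real^'d) measure). 0)"
    proof (rule integral_dominated_convergence[OF _ _ is_L2D(2)[OF g]])
      show "AE x in lborel. (\<lambda>k. (norm (G k x - ?g x))\<^sup>2) \<longlonglongrightarrow> 0"
      proof (rule AE_I2)
        fix x :: "real^'d"
        have "eventually (\<lambda>k. real k > norm x) sequentially"
          using filterlim_real_sequentially by (simp add: filterlim_at_top_dense)
        then have "eventually (\<lambda>k. (norm (G k x - ?g x))\<^sup>2 = 0) sequentially"
          by eventually_elim (auto simp: G_def)
        then show "(\<lambda>k. (norm (G k x - ?g x))\<^sup>2) \<longlonglongrightarrow> 0" by (rule tendsto_eventually)
      qed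
      show "AE x in lborel. norm ((norm (G k x - ?g x))\<^sup>2) \<le> (norm (?g x))\<^sup>2" for k
        by (rule AE_I2) (auto simp: G_def split: split_indicator)
    qed (use Gm in auto)
    then have "(\<lambda>k. LINT x|lborel. (norm (G k x - ?g x))\<^sup>2) \<longlonglongrightarrow> 0" by simp
    then have "(\<lambda>k. ennreal (LINT x|lborel. (norm (G k x - ?g x))\<^sup>2)) \<longlonglongrightarrow> ennreal 0"
      by (rule tendsto_ennrealI)
    then show ?thesis
      using L2_norm_sq_eq_integral[OF is_L2_diff[OF G2 g]] by simp
  qed
  have "L2_norm_sq (\<lambda>u. fourier (G k) u - h u) = ennreal ?K * L2_norm_sq (\<lambda>x. G k x - ?g x)" for k
  proof -
    have "ennreal ?K * L2_norm_sq (\<lambda>x. ?g x - G k x)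
        = (ennreal ?K * ennreal (1 / ?K)) * L2_norm_sq (\<lambda>u. h u - fourier (G k) u)"
      unfolding plancherel_mixed[OF G1 G2 h] by (simp add: mult.assoc)
    also have "ennreal ?K * ennreal (1 / ?K) = 1"
      by (simp flip: ennreal_mult)
    finally show ?thesis by (simp add: L2_norm_sq_minus_commute[of h] L2_norm_sq_minus_commute[of ?g])
  qed
  moreover have "(\<lambda>k. ennreal ?K * L2_norm_sq (\<lambda>x. G k x - ?g x)) \<longlonglongrightarrow> ennreal ?K * 0"
    by (intro ennreal_tendsto_cmult conv) simp
  ultimately have "(\<lambda>k. L2_norm_sq (\<lambda>u. fourier (G k) u - h u)) \<longlonglongrightarrow> 0"
    by simp
  then show ?thesis
    unfolding has_L2_fourier_def using g h(2) G1 G2 conv by blast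
qed

text \<open>
  Along a sequence \<open>G k\<close> that defines the relation, the inequality holds by Plancherel up to remainders that
  tend to \<open>0\<close>; the factor \<open>(1 + d)\<^sup>2\<close>, one \<open>1 + d\<close> for each of the two uses of the weighted triangle
  inequality, is removed at the end.
\<close>

lemma L2_dist_ge_fourier_dist:
  fixes f :: "real^'d \<Rightarrow> complex"
  assumes f: "integrable lborel f" "is_L2 f" and g: "has_L2_fourier g h"
  shows "ennreal (1 / (2 * pi) ^ CARD('d)) * L2_norm_sq (\<lambda>u. fourier f u - h u) \<le> L2_norm_sq (\<lambda>x. f x - g x)"
    (is "ennreal (1 / ?K) * ?P \<le> ?Q")
proof -
  from g obtain G where g2: "is_L2 g" and h2: "is_L2 h"
    and G: "\<And>k. integrable lborel (G k)" "\<And>k. is_L2 (G k)"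
    and lim: "(\<lambda>k. L2_norm_sq (\<lambda>x. G k x - g x)) \<longlonglongrightarrow> 0" "(\<lambda>k. L2_norm_sq (\<lambda>u. fourier (G k) u - h u)) \<longlonglongrightarrow> 0"
    unfolding has_L2_fourier_def by blast
  note meas = is_L2D(1)[OF f(2)] is_L2D(1)[OF g2] is_L2D(1)[OF h2] is_L2D(1)[OF G(2)]
    is_L2D(1)[OF plancherel_L2(1)[OF f]] is_L2D(1)[OF plancherel_L2(1)[OF G]]
  have K1: "ennreal (1 / ?K) * ennreal ?K = 1" by (simp flip: ennreal_mult)
  have bound: "ennreal (1 / ?K) * ?P \<le> ennreal ((1 + d)\<^sup>2) * ?Q" if "d > 0" for d :: real
  proof -
    define r where "r k = ennreal ((1 + d) * (1 + 1 / d)) * L2_norm_sq (\<lambda>x. G k x - g x)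
        + ennreal (1 / ?K * (1 + 1 / d)) * L2_norm_sq (\<lambda>u. fourier (G k) u - h u)" for k
    have "ennreal (1 / ?K) * ?P \<le> ennreal ((1 + d)\<^sup>2) * ?Q + r k" for k
    proof -
      have "ennreal (1 / ?K) * ?P \<le> ennreal (1 / ?K) * (ennreal (1 + d) * L2_norm_sq (\<lambda>u. fourier f u - fourier (G k) u)
          + ennreal (1 + 1 / d) * L2_norm_sq (\<lambda>u. fourier (G k) u - h u))"
        by (intro mult_left_mono L2_norm_sq_triangle meas that) simp
      also have "\<dots> = (ennreal (1 / ?K) * ennreal ?K) * (ennreal (1 + d) * L2_norm_sq (\<lambda>x. f x - G k x))
          + ennreal (1 / ?K) * ennreal (1 + 1 / d) * L2_norm_sq (\<lambda>u. fourier (G k) u - h u)"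
        unfolding plancherel_diff[OF f G] by (simp add: distrib_left mult_ac)
      also have "\<dots> = ennreal (1 + d) * L2_norm_sq (\<lambda>x. f x - G k x)
          + ennreal (1 / ?K * (1 + 1 / d)) * L2_norm_sq (\<lambda>u. fourier (G k) u - h u)"
      proof -
        have "ennreal (1 / ?K) * ennreal (1 + 1 / d) = ennreal (1 / ?K * (1 + 1 / d))"
          using that by (intro ennreal_mult[symmetric]) auto
        then show ?thesis by (simp only: K1 mult_1_left)
      qed
      also have "L2_norm_sq (\<lambda>x. f x - G k x)
          \<le> ennreal (1 + d) * ?Q + ennreal (1 + 1 / d) * L2_norm_sq (\<lambda>x. g x - G k x)"
        by (intro L2_norm_sq_triangle meas that)
      also have "ennreal (1 + d) * (ennreal (1 + d) * ?Q + ennreal (1 + 1 / d) * L2_norm_sq (\<lambda>x. g x - G k x))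
          = ennreal ((1 + d)\<^sup>2) * ?Q + ennreal ((1 + d) * (1 + 1 / d)) * L2_norm_sq (\<lambda>x. G k x - g x)"
      proof -
        have "ennreal (1 + d) * ennreal (1 + d) = ennreal ((1 + d)\<^sup>2)"
          "ennreal (1 + d) * ennreal (1 + 1 / d) = ennreal ((1 + d) * (1 + 1 / d))"
          using that unfolding power2_eq_square by (auto intro!: ennreal_mult[symmetric] add_nonneg_nonneg simp del: ennreal_plus)
        then show ?thesis
          by (simp only: L2_norm_sq_minus_commute[of g] distrib_left mult.assoc[symmetric])
      qed
      finally show ?thesis
        unfolding r_def by (simp add: mult_left_mono add_mono add.assoc)
    qed
    moreover have "r \<longlonglongrightarrow> ennreal ((1 + d) * (1 + 1 / d)) * 0 + ennreal (1 / ?K * (1 + 1 / d)) * 0"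
      unfolding r_def[abs_def] by (intro tendsto_add ennreal_tendsto_cmult lim) simp_all
    then have "(\<lambda>k. ennreal ((1 + d)\<^sup>2) * ?Q + r k) \<longlonglongrightarrow> ennreal ((1 + d)\<^sup>2) * ?Q + 0"
      by (intro tendsto_add tendsto_const) simp
    ultimately show ?thesis
      by (intro LIMSEQ_le_const[of _ "ennreal ((1 + d)\<^sup>2) * ?Q"]) auto
  qed
  show ?thesis
  proof (rule LIMSEQ_le_const)
    have "(\<lambda>k. ennreal ((1 + 1 / real (Suc k))\<^sup>2)) \<longlonglongrightarrow> ennreal ((1 + 0)\<^sup>2)"
      by (intro tendsto_intros tendsto_ennrealI LIMSEQ_Suc[OF lim_1_over_n])
    moreover have "?Q \<noteq> \<infinity>"
      using is_L2_diff[OF f(2) g2] by (simp add: is_L2_def less_top)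
    ultimately have "(\<lambda>k. ?Q * ennreal ((1 + 1 / real (Suc k))\<^sup>2)) \<longlonglongrightarrow> ?Q * ennreal ((1 + 0)\<^sup>2)"
      by (intro ennreal_tendsto_cmult) (auto simp: less_top)
    then show "(\<lambda>k. ennreal ((1 + 1 / real (Suc k))\<^sup>2) * ?Q) \<longlonglongrightarrow> ?Q"
      by (simp add: mult.commute)
    show "\<exists>N. \<forall>k\<ge>N. ennreal (1 / ?K) * ?P \<le> ennreal ((1 + 1 / real (Suc k))\<^sup>2) * ?Q"
      by (intro exI allI impI bound) simp
  qed
qed

text \<open>
  The approximation error \<open>f - f\<^bsub>A,m\<^esub>\<close> controls what the cut-off removes on the Fourier side. The choice in
  \<open>spectral_cutoff\<close> is legitimate because \<open>has_L2_fourier_inv\<close> provides a candidate, and the bound holds for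
  any representative.
\<close>

lemma spectral_cutoff_error_ge:
  fixes f :: "real^'d \<Rightarrow> complex"
  assumes f: "integrable lborel f" "is_L2 f"
  shows "ennreal (1 / (2 * pi) ^ CARD('d)) * L2_norm_sq (\<lambda>u. fourier f u * indicator (- ((*v) A ` sym_box m)) u)
    \<le> L2_norm_sq (\<lambda>x. f x - spectral_cutoff f A m x)"
proof -
  let ?S = "(*v) A ` sym_box m"
  let ?h = "\<lambda>u. fourier f u * indicator ?S u"
  have cS: "compact ?S" by (rule compact_matrix_sym_box)
  then have [measurable]: "?S \<in> sets borel" by (simp add: borel_compact)
  note F = plancherel_L2(1)[OF f]
  note [measurable] = is_L2D(1)[OF F]
  have h2: "is_L2 ?h"
    unfolding is_L2_iff
    by (intro conjI Bochner_Integration.integrable_bound[OF is_L2D(2)[OF F]]) (auto split: split_indicator)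
  have h1: "integrable lborel ?h"
  proof (rule Bochner_Integration.integrable_bound[of _ "\<lambda>u. (LINT x|lborel. norm (f x)) * indicator ?S u"])
    show "integrable lborel (\<lambda>u. (LINT x|lborel. norm (f x)) * indicator ?S u)"
      using emeasure_bounded_finite[OF compact_imp_bounded[OF cS]]
      by (intro integrable_mult_right) (simp add: integrable_indicator_iff)
  qed (auto split: split_indicator intro: norm_fourier_le order_trans[OF norm_fourier_le])
  have cut: "has_L2_fourier (spectral_cutoff f A m) ?h"
    unfolding spectral_cutoff_def by (rule someI[of _ "fourier_inv ?h"]) (rule has_L2_fourier_inv[OF h1 h2])
  have "(\<lambda>u. fourier f u - ?h u) = (\<lambda>u. fourier f u * indicator (- ?S) u)"
    by (rule ext) (auto split: split_indicator)
  with L2_dist_ge_fourier_dist[OF f cut] show ?thesis by (simp only:)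
qed

section \<open>The empirical characteristic function\<close>

lemma emp_char_measurable_pair:
  fixes X :: "nat \<Rightarrow> 'w \<Rightarrow> real^'d"
  assumes "\<And>j. j \<in> {1..n} \<Longrightarrow> X j \<in> borel_measurable M"
  shows "(\<lambda>(\<omega>, u). emp_char n (\<lambda>j. X j \<omega>) u) \<in> borel_measurable (M \<Otimes>\<^sub>M borel)"
proof -
  have "(\<lambda>x. iexp (snd x \<bullet> X j (fst x))) \<in> borel_measurable (M \<Otimes>\<^sub>M (borel :: (real^'d) measure))" if "j \<in> {1..n}" for j
  proof -
    note [measurable] = assms[OF that]
    show ?thesis by measurable
  qed
  then show ?thesis
    unfolding emp_char_def split_beta by (intro borel_measurable_times borel_measurable_const borel_measurable_sum) auto
qed

lemma thresh_char_altdef: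
  "thresh_char \<kappa> n x u = (if norm (emp_char n x u) \<ge> kappa_n \<kappa> n * real n powr (- 1/2) then emp_char n x u else 0)"
  unfolding thresh_char_def by simp

lemma thresh_char_measurable_pair:
  fixes X :: "nat \<Rightarrow> 'w \<Rightarrow> real^'d"
  assumes "\<And>j. j \<in> {1..n} \<Longrightarrow> X j \<in> borel_measurable M"
  shows "(\<lambda>(\<omega>, u). thresh_char \<kappa> n (\<lambda>j. X j \<omega>) u) \<in> borel_measurable (M \<Otimes>\<^sub>M borel)"
proof -
  note [measurable] = emp_char_measurable_pair[OF assms, unfolded split_beta]
  show ?thesis
    unfolding thresh_char_altdef split_beta by measurable
qed

lemma thresh_char_measurable [measurable]: "thresh_char \<kappa> n x \<in> borel_measurable borel"
  unfolding thresh_char_altdef[abs_def] emp_char_def by measurable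

lemma norm_emp_char_le:
  assumes "n \<ge> 1"
  shows "norm (emp_char n x u) \<le> 1"
proof -
  have "norm (emp_char n x u) = norm (\<Sum>j=1..n. iexp (u \<bullet> x j)) / real n"
    unfolding emp_char_def by (simp add: norm_mult norm_divide)
  also have "\<dots> \<le> (\<Sum>j=1..n. norm (iexp (u \<bullet> x j))) / real n"
    by (intro divide_right_mono norm_sum) simp
  also have "\<dots> = 1" using assms by simp
  finally show ?thesis .
qed

lemma norm_thresh_char_le: "n \<ge> 1 \<Longrightarrow> norm (thresh_char \<kappa> n x u) \<le> 1"
  unfolding thresh_char_altdef using norm_emp_char_le by auto

lemma powr_neg_half: "0 \<le> x \<Longrightarrow> x powr - (1 / 2) = 1 / sqrt x"
  using powr_minus_divide[of x "1 / 2"] by (simp add: powr_half_sqrt)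

context prob_space
begin

text \<open>
  Independent centred complex variables are orthogonal, so only the diagonal of the expanded square
  survives.
\<close>

lemma second_moment_sum_indep_centred:
  fixes Y :: "nat \<Rightarrow> 'a \<Rightarrow> complex"
  assumes I: "finite I" and indep: "indep_vars (\<lambda>_. borel) Y I"
    and mean: "\<And>j. j \<in> I \<Longrightarrow> expectation (Y j) = 0"
    and bound: "\<And>j \<omega>. j \<in> I \<Longrightarrow> norm (Y j \<omega>) \<le> B"
  shows "expectation (\<lambda>\<omega>. (norm (\<Sum>j\<in>I. Y j \<omega>))\<^sup>2) = (\<Sum>j\<in>I. expectation (\<lambda>\<omega>. (norm (Y j \<omega>))\<^sup>2))"
proof -
  have rv: "Y j \<in> borel_measurable M" if "j \<in> I" for j
    using indep that unfolding indep_vars_def by auto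
  have int: "integrable M (\<lambda>\<omega>. Y j \<omega> * cnj (Y k \<omega>))" if "j \<in> I" "k \<in> I" for j k
  proof (rule integrable_const_bound[of _ "B * B"])
    show "AE \<omega> in M. norm (Y j \<omega> * cnj (Y k \<omega>)) \<le> B * B"
      using that by (auto simp: norm_mult intro!: mult_mono bound order_trans[OF norm_ge_zero bound])
    show "(\<lambda>\<omega>. Y j \<omega> * cnj (Y k \<omega>)) \<in> borel_measurable M"
      using rv that by measurable
  qed
  have off: "expectation (\<lambda>\<omega>. Y j \<omega> * cnj (Y k \<omega>)) = 0" if jk: "j \<in> I" "k \<in> I" "j \<noteq> k" for j k
  proof -
    let ?Z = "\<lambda>i \<omega>. (if i = j then Y i \<omega> else cnj (Y i \<omega>))"
    have iY: "integrable M (Y i)" if "i \<in> I" for i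
      by (rule integrable_const_bound[of _ B]) (use that rv bound in auto)
    have "indep_vars (\<lambda>_. borel) (\<lambda>i x. (\<lambda>y. if i = j then y else cnj y) (Y i x)) {j, k}"
      using jk by (intro indep_vars_compose2[OF indep_vars_subset[OF indep]]) auto
    then have "indep_vars (\<lambda>_. borel) ?Z {j, k}" by simp
    then have "expectation (\<lambda>\<omega>. \<Prod>i\<in>{j, k}. ?Z i \<omega>) = (\<Prod>i\<in>{j, k}. expectation (?Z i))"
      using jk iY by (intro indep_vars_lebesgue_integral) auto
    then show ?thesis
      using jk mean by (simp split: if_splits)
  qed
  have "complex_of_real (expectation (\<lambda>\<omega>. (norm (\<Sum>j\<in>I. Y j \<omega>))\<^sup>2))
      = expectation (\<lambda>\<omega>. \<Sum>j\<in>I. \<Sum>k\<in>I. Y j \<omega> * cnj (Y k \<omega>))"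
    unfolding integral_complex_of_real[symmetric] complex_norm_square by (simp add: sum_product)
  also have "\<dots> = (\<Sum>j\<in>I. \<Sum>k\<in>I. expectation (\<lambda>\<omega>. Y j \<omega> * cnj (Y k \<omega>)))"
    using int by (simp add: Bochner_Integration.integral_sum)
  also have "\<dots> = (\<Sum>j\<in>I. expectation (\<lambda>\<omega>. Y j \<omega> * cnj (Y j \<omega>)))"
  proof (intro sum.cong refl)
    fix j assume "j \<in> I"
    then have "(\<Sum>k\<in>I. expectation (\<lambda>\<omega>. Y j \<omega> * cnj (Y k \<omega>)))
        = (\<Sum>k\<in>I. if k = j then expectation (\<lambda>\<omega>. Y j \<omega> * cnj (Y j \<omega>)) else 0)"
      by (intro sum.cong refl) (use off in auto)
    with \<open>j \<in> I\<close> I show "(\<Sum>k\<in>I. expectation (\<lambda>\<omega>. Y j \<omega> * cnj (Y k \<omega>))) = expectation (\<lambda>\<omega>. Y j \<omega> * cnj (Y j \<omega>))"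
      by simp
  qed
  also have "\<dots> = complex_of_real (\<Sum>j\<in>I. expectation (\<lambda>\<omega>. (norm (Y j \<omega>))\<^sup>2))"
    unfolding of_real_sum integral_complex_of_real[symmetric] complex_norm_square ..
  finally show ?thesis by (simp only: of_real_eq_iff)
qed

context
  fixes X :: "nat \<Rightarrow> 'a \<Rightarrow> real^'d" and n :: nat and u :: "real^'d" and q :: complex
  assumes n: "n \<ge> 1" and indep: "indep_vars (\<lambda>_. borel) X {1..n}"
    and q: "\<And>j. j \<in> {1..n} \<Longrightarrow> expectation (\<lambda>\<omega>. iexp (u \<bullet> X j \<omega>)) = q"
begin

private lemma rv: "j \<in> {1..n} \<Longrightarrow> X j \<in> borel_measurable M"
  using indep unfolding indep_vars_def by auto

private lemma iexp_rv: "j \<in> {1..n} \<Longrightarrow> (\<lambda>\<omega>. iexp (u \<bullet> X j \<omega>)) \<in> borel_measurable M"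
proof -
  assume "j \<in> {1..n}"
  note [measurable] = rv[OF this]
  show ?thesis by measurable
qed

private lemma iexp_int: "j \<in> {1..n} \<Longrightarrow> integrable M (\<lambda>\<omega>. iexp (u \<bullet> X j \<omega>))"
  by (rule integrable_const_bound[of _ 1]) (auto intro: iexp_rv)

lemma norm_char_le: "norm q \<le> 1"
proof -
  have "norm q \<le> expectation (\<lambda>\<omega>. norm (iexp (u \<bullet> X 1 \<omega>)))"
    using q[of 1] n by (intro order_trans[OF _ integral_norm_bound]) auto
  then show ?thesis by (simp add: prob_space)
qed

private lemma emp_rv [measurable]: "(\<lambda>\<omega>. emp_char n (\<lambda>j. X j \<omega>) u) \<in> borel_measurable M"
  unfolding emp_char_def by (intro borel_measurable_times borel_measurable_const borel_measurable_sum iexp_rv)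

text \<open>
  A single summand has variance \<open>1 - (norm q)\<^sup>2 \<le> 1\<close>, since its modulus is \<open>1\<close>.
\<close>

lemma emp_char_second_moment:
  "(\<integral>\<^sup>+\<omega>. ennreal ((norm (emp_char n (\<lambda>j. X j \<omega>) u - q))\<^sup>2) \<partial>M) \<le> ennreal (1 / real n)"
proof -
  let ?Y = "\<lambda>j \<omega>. iexp (u \<bullet> X j \<omega>) - q"
  have eq: "emp_char n (\<lambda>j. X j \<omega>) u - q = (\<Sum>j=1..n. ?Y j \<omega>) / real n" for \<omega>
    unfolding emp_char_def using n by (simp add: sum_subtractf field_simps)
  have bY: "norm (?Y j \<omega>) \<le> 2" for j \<omega>
    using norm_triangle_ineq4[of "iexp (u \<bullet> X j \<omega>)" q] norm_char_le by simp
  have iY: "indep_vars (\<lambda>_. borel) ?Y {1..n}"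
    by (rule indep_vars_compose2[OF indep, of "\<lambda>_ x. iexp (u \<bullet> x) - q"]) measurable
  have mY: "expectation (?Y j) = 0" if "j \<in> {1..n}" for j
    using iexp_int[OF that] q[OF that] by (simp add: prob_space)
  have one: "expectation (\<lambda>\<omega>. (norm (?Y j \<omega>))\<^sup>2) \<le> 1" if j: "j \<in> {1..n}" for j
  proof -
    have "(norm (?Y j \<omega>))\<^sup>2 = 1 + (norm q)\<^sup>2 - 2 * Re (cnj q * iexp (u \<bullet> X j \<omega>))" for \<omega>
    proof -
      have "(norm (a - b))\<^sup>2 = (norm a)\<^sup>2 + (norm b)\<^sup>2 - 2 * Re (cnj b * a)" for a b :: complex
        unfolding cmod_power2 by (simp add: power2_eq_square algebra_simps)
      from this[of "iexp (u \<bullet> X j \<omega>)" q] show ?thesis by simp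
    qed
    then have "expectation (\<lambda>\<omega>. (norm (?Y j \<omega>))\<^sup>2)
        = expectation (\<lambda>\<omega>. 1 + (norm q)\<^sup>2 - 2 * Re (cnj q * iexp (u \<bullet> X j \<omega>)))"
      by simp
    also have "\<dots> = expectation (\<lambda>\<omega>. 1 + (norm q)\<^sup>2) - expectation (\<lambda>\<omega>. 2 * Re (cnj q * iexp (u \<bullet> X j \<omega>)))"
      by (rule Bochner_Integration.integral_diff)
         (simp, intro integrable_mult_right integrable_Re iexp_int j)
    also have "expectation (\<lambda>\<omega>. 2 * Re (cnj q * iexp (u \<bullet> X j \<omega>))) = 2 * Re (cnj q * q)"
      unfolding integral_mult_right_zero integral_Re[OF integrable_mult_right[OF iexp_int[OF j]]] q[OF j] ..
    also have "Re (cnj q * q) = (norm q)\<^sup>2"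
      unfolding cmod_power2 by (simp add: power2_eq_square)
    finally show ?thesis by (simp add: prob_space)
  qed
  have int: "integrable M (\<lambda>\<omega>. (norm (emp_char n (\<lambda>j. X j \<omega>) u - q))\<^sup>2)"
  proof (rule integrable_const_bound[of _ 4])
    show "AE \<omega> in M. norm ((norm (emp_char n (\<lambda>j. X j \<omega>) u - q))\<^sup>2) \<le> 4"
    proof (rule AE_I2)
      fix \<omega>
      have "norm (emp_char n (\<lambda>j. X j \<omega>) u - q) \<le> 2"
        using norm_triangle_ineq4[of "emp_char n (\<lambda>j. X j \<omega>) u" q] norm_char_le norm_emp_char_le[OF n, of "\<lambda>j. X j \<omega>" u] by simp
      then have "(norm (emp_char n (\<lambda>j. X j \<omega>) u - q))\<^sup>2 \<le> 2\<^sup>2" by (intro power_mono) auto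
      then show "norm ((norm (emp_char n (\<lambda>j. X j \<omega>) u - q))\<^sup>2) \<le> 4" by simp
    qed
  qed measurable
  have "expectation (\<lambda>\<omega>. (norm (emp_char n (\<lambda>j. X j \<omega>) u - q))\<^sup>2)
      = expectation (\<lambda>\<omega>. (norm (\<Sum>j=1..n. ?Y j \<omega>))\<^sup>2) / (real n)\<^sup>2"
    unfolding eq by (simp add: norm_divide power_divide)
  also have "\<dots> = (\<Sum>j=1..n. expectation (\<lambda>\<omega>. (norm (?Y j \<omega>))\<^sup>2)) / (real n)\<^sup>2"
    using second_moment_sum_indep_centred[OF _ iY mY bY] by simp
  also have "\<dots> \<le> (\<Sum>j=1..n. 1) / (real n)\<^sup>2"
    by (intro divide_right_mono sum_mono one) auto
  also have "\<dots> = 1 / real n"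
    using n by (simp add: power2_eq_square)
  finally show ?thesis
    using int by (subst nn_integral_eq_integral) (auto simp: ennreal_leI)
qed

text \<open>
  Treats the real and the imaginary part at once, through the linear map \<open>g\<close>. Hoeffding's inequality
  applies because each summand lies in an interval of length \<open>2\<close>.
\<close>

private lemma hoeffding_component:
  assumes g: "\<And>z. g z = Re z \<or> g z = Im z" and lin: "bounded_linear g" and s: "s \<ge> 0"
  shows "prob {\<omega>\<in>space M. \<bar>g (emp_char n (\<lambda>j. X j \<omega>) u - q)\<bar> \<ge> s} \<le> 2 * exp (- real n * s\<^sup>2 / 2)"
proof -
  interpret g: bounded_linear g by (rule lin)
  have gm [measurable]: "g \<in> borel_measurable borel"
    by (intro borel_measurable_continuous_onI linear_continuous_on lin)
  have gle: "\<bar>g z\<bar> \<le> norm z" for z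
    using g[of z] abs_Re_le_cmod[of z] abs_Im_le_cmod[of z] by auto
  let ?Z = "\<lambda>j \<omega>. g (iexp (u \<bullet> X j \<omega>))"
  have ind: "indep_vars (\<lambda>_. borel) ?Z {1..n}"
    by (rule indep_vars_compose2[OF indep, of "\<lambda>_ x. g (iexp (u \<bullet> x))"]) measurable
  interpret H: Hoeffding_ineq M "{1..n}" ?Z "\<lambda>_. -1" "\<lambda>_. 1" "\<Sum>j\<in>{1..n}. expectation (?Z j)"
  proof unfold_locales
    fix j
    have "\<bar>?Z j \<omega>\<bar> \<le> 1" for \<omega> using gle[of "iexp (u \<bullet> X j \<omega>)"] by simp
    then show "AE \<omega> in M. ?Z j \<omega> \<in> {- 1..1}" by (auto simp: abs_le_iff)
  qed (use ind in auto)
  have "expectation (?Z j) = g q" if "j \<in> {1..n}" for j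
    unfolding q[OF that, symmetric] by (rule integral_bounded_linear[OF lin iexp_int[OF that]])
  then have mu: "(\<Sum>j\<in>{1..n}. expectation (?Z j)) = real n * g q" by simp
  have eq: "g (emp_char n (\<lambda>j. X j \<omega>) u - q) = ((\<Sum>j=1..n. ?Z j \<omega>) - real n * g q) / real n" for \<omega>
  proof -
    have "emp_char n (\<lambda>j. X j \<omega>) u - q = (1 / real n) *\<^sub>R (\<Sum>j=1..n. iexp (u \<bullet> X j \<omega>)) - q"
      unfolding emp_char_def by (simp add: scaleR_conv_of_real)
    then show ?thesis
      using n by (simp add: g.diff g.scaleR g.sum field_simps)
  qed
  have "{\<omega>\<in>space M. \<bar>g (emp_char n (\<lambda>j. X j \<omega>) u - q)\<bar> \<ge> s}
      = {\<omega>\<in>space M. \<bar>(\<Sum>j=1..n. ?Z j \<omega>) - (\<Sum>j\<in>{1..n}. expectation (?Z j))\<bar> \<ge> real n * s}"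
    unfolding mu eq using n by (simp add: abs_divide pos_le_divide_eq mult.commute)
  also have "prob \<dots> \<le> 2 * exp (- 2 * (real n * s)\<^sup>2 / (\<Sum>j\<in>{1..n}. (1 - - 1)\<^sup>2))"
    using n s by (intro H.Hoeffding_ineq_abs_ge) auto
  also have "- 2 * (real n * s)\<^sup>2 / (\<Sum>j\<in>{1..n}. (1 - - 1)\<^sup>2) = - real n * s\<^sup>2 / 2"
    using n by (simp add: power2_eq_square field_simps)
  finally show ?thesis .
qed

text \<open>
  A complex number of modulus at least \<open>s\<close> has a real or an imaginary part of modulus at least
  \<open>s / sqrt 2\<close>; four tails in total are summed.
\<close>

lemma emp_char_deviation:
  assumes s: "s \<ge> 0"
  shows "prob {\<omega>\<in>space M. norm (emp_char n (\<lambda>j. X j \<omega>) u - q) \<ge> s} \<le> 4 * exp (- real n * s\<^sup>2 / 4)"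
proof -
  let ?z = "\<lambda>\<omega>. emp_char n (\<lambda>j. X j \<omega>) u - q" and ?t = "s / sqrt 2"
  let ?R = "{\<omega>\<in>space M. \<bar>Re (?z \<omega>)\<bar> \<ge> ?t}" and ?I = "{\<omega>\<in>space M. \<bar>Im (?z \<omega>)\<bar> \<ge> ?t}"
  have t: "?t \<ge> 0" "?t\<^sup>2 = s\<^sup>2 / 2" using s by (auto simp: power_divide)
  have "norm z < s" if "\<bar>Re z\<bar> < ?t" "\<bar>Im z\<bar> < ?t" for z :: complex
  proof -
    have "(Re z)\<^sup>2 < ?t\<^sup>2" "(Im z)\<^sup>2 < ?t\<^sup>2"
      using power_strict_mono[OF that(1), of 2] power_strict_mono[OF that(2), of 2] by simp_all
    then have "(norm z)\<^sup>2 < s\<^sup>2" unfolding cmod_power2 t(2) by simp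
    then show ?thesis using s by (rule power2_less_imp_less)
  qed
  then have "{\<omega>\<in>space M. norm (?z \<omega>) \<ge> s} \<subseteq> ?R \<union> ?I"
    by (auto simp: not_less[symmetric])
  then have "prob {\<omega>\<in>space M. norm (?z \<omega>) \<ge> s} \<le> prob (?R \<union> ?I)"
    by (intro finite_measure_mono) measurable
  also have "\<dots> \<le> prob ?R + prob ?I"
    by (intro measure_Un_le) measurable
  also have "\<dots> \<le> 2 * exp (- real n * ?t\<^sup>2 / 2) + 2 * exp (- real n * ?t\<^sup>2 / 2)"
    by (intro add_mono hoeffding_component t bounded_linear_Re bounded_linear_Im) auto
  finally show ?thesis unfolding t(2) by simp
qed

text \<open>
  The bound used at the frequencies retained by the oracle. Whether or not \<open>u\<close> passes the threshold \<open>t\<close>,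
  the loss is at most \<open>2 * (norm (p - q))\<^sup>2 + 2 * t\<^sup>2\<close>: when the empirical value \<open>p\<close> is set to zero, \<open>norm p < t\<close>
  bounds \<open>norm q\<close> by \<open>norm (p - q) + t\<close>.
\<close>

lemma risk_le_variance:
  assumes \<kappa>: "\<kappa> > 0"
  shows "(\<integral>\<^sup>+\<omega>. ennreal ((norm (thresh_char \<kappa> n (\<lambda>j. X j \<omega>) u - q))\<^sup>2) \<partial>M)
    \<le> ennreal ((10 + 2 * (1 + (\<kappa> + 2) * sqrt (ln (real n)))\<^sup>2) / real n)"
proof -
  let ?p = "\<lambda>\<omega>. emp_char n (\<lambda>j. X j \<omega>) u"
  define t where "t = kappa_n \<kappa> n * real n powr (- 1 / 2)"
  have L: "0 \<le> sqrt (ln (real n))" using n by simp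
  have t: "t \<ge> 0" "t\<^sup>2 = (kappa_n \<kappa> n)\<^sup>2 / real n"
    using L \<kappa> by (auto simp: t_def powr_neg_half kappa_n_def power_divide)
  have le: "(norm (thresh_char \<kappa> n (\<lambda>j. X j \<omega>) u - q))\<^sup>2 \<le> 2 * (norm (?p \<omega> - q))\<^sup>2 + 2 * t\<^sup>2" for \<omega>
  proof (cases "norm (?p \<omega>) \<ge> t")
    case True
    then show ?thesis unfolding thresh_char_altdef t_def[symmetric] by simp
  next
    case False
    have "norm q \<le> norm (?p \<omega> - q) + t"
      using norm_triangle_ineq2[of q "?p \<omega>"] False by (simp add: norm_minus_commute)
    then have "(norm q)\<^sup>2 \<le> (norm (?p \<omega> - q) + t)\<^sup>2" by (intro power_mono) auto
    also have "\<dots> \<le> 2 * (norm (?p \<omega> - q))\<^sup>2 + 2 * t\<^sup>2"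
      using sum_squares_bound[of "norm (?p \<omega> - q)" t] by (simp add: power2_sum)
    finally show ?thesis using False unfolding thresh_char_altdef t_def[symmetric] by simp
  qed
  have add: "ennreal (2 * a + 2 * t\<^sup>2) = ennreal 2 * ennreal a + ennreal (2 * t\<^sup>2)" if "a \<ge> 0" for a
    using that by (subst ennreal_plus) (auto simp: ennreal_mult)
  have "(\<integral>\<^sup>+\<omega>. ennreal ((norm (thresh_char \<kappa> n (\<lambda>j. X j \<omega>) u - q))\<^sup>2) \<partial>M)
      \<le> (\<integral>\<^sup>+\<omega>. ennreal 2 * ennreal ((norm (?p \<omega> - q))\<^sup>2) + ennreal (2 * t\<^sup>2) \<partial>M)"
    unfolding add[OF zero_le_power2, symmetric] by (intro nn_integral_mono ennreal_leI le)
  also have "\<dots> = ennreal 2 * (\<integral>\<^sup>+\<omega>. ennreal ((norm (?p \<omega> - q))\<^sup>2) \<partial>M) + ennreal (2 * t\<^sup>2)"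
    by (subst nn_integral_add; (subst nn_integral_cmult)?) (measurable, simp add: emeasure_space_1)
  also have "\<dots> \<le> ennreal 2 * ennreal (1 / real n) + ennreal (2 * t\<^sup>2)"
    by (intro add_mono mult_left_mono emp_char_second_moment) auto
  also have "\<dots> = ennreal (2 * (1 / real n) + 2 * t\<^sup>2)"
    by (rule add[symmetric]) simp
  also have "\<dots> \<le> ennreal ((10 + 2 * (1 + (\<kappa> + 2) * sqrt (ln (real n)))\<^sup>2) / real n)"
  proof (rule ennreal_leI)
    have "(kappa_n \<kappa> n)\<^sup>2 \<le> (1 + (\<kappa> + 2) * sqrt (ln (real n)))\<^sup>2"
      unfolding kappa_n_def using L \<kappa> by (intro power_mono) (auto simp: mult_right_mono)
    then have "(2 + 2 * (kappa_n \<kappa> n)\<^sup>2) / real n \<le> (10 + 2 * (1 + (\<kappa> + 2) * sqrt (ln (real n)))\<^sup>2) / real n"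
      by (intro divide_right_mono) auto
    then show "2 * (1 / real n) + 2 * t\<^sup>2 \<le> (10 + 2 * (1 + (\<kappa> + 2) * sqrt (ln (real n)))\<^sup>2) / real n"
      unfolding t(2) by (simp add: add_divide_distrib)
  qed
  finally show ?thesis .
qed

text \<open>
  The bound used at the frequencies discarded by the oracle. If \<open>(norm q)\<^sup>2\<close> is at least \<open>1 / (17 * n)\<close>, the
  trivial loss bound \<open>(norm q)\<^sup>2 + (norm (p - q))\<^sup>2\<close> has expectation at most \<open>18 * (norm q)\<^sup>2\<close>, which is where
  the constant \<open>18\<close> comes from. Otherwise \<open>norm q\<close> is smaller than the summand \<open>1 / sqrt n\<close> of the threshold,
  so passing the threshold forces a deviation of at least \<open>\<kappa> * sqrt (ln n / n)\<close>, and this has probability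
  at most \<open>4 * n powr (- \<kappa>\<^sup>2 / 4)\<close>.
\<close>

lemma risk_le_bias:
  assumes \<kappa>: "\<kappa> > 0"
  shows "(\<integral>\<^sup>+\<omega>. ennreal ((norm (thresh_char \<kappa> n (\<lambda>j. X j \<omega>) u - q))\<^sup>2) \<partial>M)
    \<le> ennreal (18 * (norm q)\<^sup>2 + 64 * real n powr (- \<kappa>\<^sup>2 / 4))"
proof -
  let ?p = "\<lambda>\<omega>. emp_char n (\<lambda>j. X j \<omega>) u"
  define t where "t = kappa_n \<kappa> n * real n powr (- 1 / 2)"
  have thr: "thresh_char \<kappa> n (\<lambda>j. X j \<omega>) u = (if norm (?p \<omega>) \<ge> t then ?p \<omega> else 0)" for \<omega>
    unfolding thresh_char_altdef t_def ..
  show ?thesis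
  proof (cases "(norm q)\<^sup>2 \<ge> 1 / (17 * real n)")
    case True
    have "(\<integral>\<^sup>+\<omega>. ennreal ((norm (thresh_char \<kappa> n (\<lambda>j. X j \<omega>) u - q))\<^sup>2) \<partial>M)
        \<le> (\<integral>\<^sup>+\<omega>. ennreal ((norm (?p \<omega> - q))\<^sup>2) + ennreal ((norm q)\<^sup>2) \<partial>M)"
      unfolding thr by (intro nn_integral_mono) (auto simp flip: ennreal_plus intro!: ennreal_leI)
    also have "\<dots> = (\<integral>\<^sup>+\<omega>. ennreal ((norm (?p \<omega> - q))\<^sup>2) \<partial>M) + ennreal ((norm q)\<^sup>2)"
      by (subst nn_integral_add) (measurable, simp add: emeasure_space_1)
    also have "\<dots> \<le> ennreal (1 / real n) + ennreal ((norm q)\<^sup>2)"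
      by (intro add_mono emp_char_second_moment) auto
    also have "\<dots> = ennreal (1 / real n + (norm q)\<^sup>2)"
      by (subst ennreal_plus) auto
    also have "\<dots> \<le> ennreal (18 * (norm q)\<^sup>2 + 64 * real n powr (- \<kappa>\<^sup>2 / 4))"
    proof (rule ennreal_leI)
      have "1 / real n \<le> 17 * (norm q)\<^sup>2" using True n by (simp add: field_simps)
      then show "1 / real n + (norm q)\<^sup>2 \<le> 18 * (norm q)\<^sup>2 + 64 * real n powr (- \<kappa>\<^sup>2 / 4)"
        using powr_ge_zero[of "real n" "- \<kappa>\<^sup>2 / 4"] by linarith
    qed
    finally show ?thesis .
  next
    case False
    define L where "L = sqrt (ln (real n))"
    have L: "L \<ge> 0" "L\<^sup>2 = ln (real n)" using n by (auto simp: L_def)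
    define s where "s = \<kappa> * L / sqrt (real n)"
    have s: "s \<ge> 0" using \<kappa> L n by (auto simp: s_def)
    have s2: "s\<^sup>2 = \<kappa>\<^sup>2 * ln (real n) / real n"
      using L n by (simp add: s_def power_divide power_mult_distrib)
    let ?D = "{\<omega>\<in>space M. norm (?p \<omega> - q) \<ge> s}"
    have tq: "t - norm q \<ge> s"
    proof -
      have "(norm q)\<^sup>2 \<le> (1 / sqrt (real n))\<^sup>2"
        using False n by (simp add: power_divide field_simps)
      then have "norm q \<le> 1 / sqrt (real n)"
        by (rule power2_le_imp_le) simp
      moreover have "t = (1 + \<kappa> * L) / sqrt (real n)"
        unfolding t_def kappa_n_def L_def by (simp add: powr_neg_half)
      ultimately show ?thesis unfolding s_def by (simp add: add_divide_distrib)
    qed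
    have le: "(norm (thresh_char \<kappa> n (\<lambda>j. X j \<omega>) u - q))\<^sup>2 \<le> (norm q)\<^sup>2 + 4 * indicator ?D \<omega>" if "\<omega> \<in> space M" for \<omega>
    proof (cases "norm (?p \<omega>) \<ge> t")
      case True
      have "s \<le> norm (?p \<omega> - q)"
        using tq True norm_triangle_ineq2[of "?p \<omega>" q] by linarith
      moreover have "norm (?p \<omega> - q) \<le> 2"
        using norm_triangle_ineq4[of "?p \<omega>" q] norm_char_le norm_emp_char_le[OF n, of "\<lambda>j. X j \<omega>" u] by simp
      then have "(norm (?p \<omega> - q))\<^sup>2 \<le> 2\<^sup>2" by (intro power_mono) auto
      ultimately show ?thesis using True that unfolding thr by (simp add: add_increasing)
    next
      case False
      then show ?thesis unfolding thr by simp
    qed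
    have ind: "ennreal ((norm q)\<^sup>2 + 4 * indicator ?D \<omega>) = ennreal ((norm q)\<^sup>2) + ennreal 4 * indicator ?D \<omega>" for \<omega>
      by (subst ennreal_plus) (auto split: split_indicator)
    have "(\<integral>\<^sup>+\<omega>. ennreal ((norm (thresh_char \<kappa> n (\<lambda>j. X j \<omega>) u - q))\<^sup>2) \<partial>M)
        \<le> (\<integral>\<^sup>+\<omega>. ennreal ((norm q)\<^sup>2) + ennreal 4 * indicator ?D \<omega> \<partial>M)"
      unfolding ind[symmetric] by (intro nn_integral_mono ennreal_leI le)
    also have "\<dots> = ennreal ((norm q)\<^sup>2) + ennreal 4 * emeasure M ?D"
      by (subst nn_integral_add; (subst nn_integral_cmult)?) (measurable, simp add: emeasure_space_1)
    also have "\<dots> = ennreal ((norm q)\<^sup>2 + 4 * prob ?D)"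
      by (subst ennreal_plus) (auto simp: emeasure_eq_measure ennreal_mult)
    also have "\<dots> \<le> ennreal (18 * (norm q)\<^sup>2 + 64 * real n powr (- \<kappa>\<^sup>2 / 4))"
    proof (rule ennreal_leI)
      have "prob ?D \<le> 4 * exp (- real n * s\<^sup>2 / 4)" by (rule emp_char_deviation[OF s])
      also have "- real n * s\<^sup>2 / 4 = (- \<kappa>\<^sup>2 / 4) * ln (real n)"
        unfolding s2 using n by simp
      also have "exp ((- \<kappa>\<^sup>2 / 4) * ln (real n)) = real n powr (- \<kappa>\<^sup>2 / 4)"
        using n by (simp add: powr_def)
      finally have "prob ?D \<le> 4 * real n powr (- \<kappa>\<^sup>2 / 4)" .
      then show "(norm q)\<^sup>2 + 4 * prob ?D \<le> 18 * (norm q)\<^sup>2 + 64 * real n powr (- \<kappa>\<^sup>2 / 4)"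
        using zero_le_power2[of "norm q"] powr_ge_zero[of "real n" "- \<kappa>\<^sup>2 / 4"] by linarith
    qed
    finally show ?thesis .
  qed
qed

end

end

section \<open>The oracle inequality\<close>

lemma fourier_eq_expectation:
  fixes X :: "'w \<Rightarrow> real^'d" and f :: "real^'d \<Rightarrow> real"
  assumes X: "distributed M lborel X (\<lambda>x. ennreal (f x))" and f: "AE x in lborel. 0 \<le> f x" "f \<in> borel_measurable borel"
  shows "(LINT \<omega>|M. iexp (u \<bullet> X \<omega>)) = fourier (\<lambda>x. complex_of_real (f x)) u"
proof -
  have Xm: "X \<in> M \<rightarrow>\<^sub>M lborel" using X by (rule distributed_measurable)
  have "(LINT \<omega>|M. iexp (u \<bullet> X \<omega>)) = (LINT x|distr M lborel X. iexp (u \<bullet> x))"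
    by (rule integral_distr[OF Xm, symmetric]) simp
  also have "\<dots> = (LINT x|lborel. f x *\<^sub>R iexp (u \<bullet> x))"
    unfolding distributed_distr_eq_density[OF X] using f by (intro integral_density) auto
  also have "\<dots> = fourier (\<lambda>x. complex_of_real (f x)) u"
    unfolding fourier_def by (simp add: scaleR_conv_of_real mult.commute)
  finally show ?thesis .
qed

lemma fourier_estimator_eq:
  "fourier_estimator \<kappa> n x = fourier_inv (\<lambda>u. thresh_char \<kappa> n x u * indicator (sym_box (\<chi> i. real n)) u)"
  unfolding fourier_estimator_def fourier_inv_def fourier_def set_lebesgue_integral_def
  by (rule ext) (simp add: inner_commute scaleR_conv_of_real mult_ac of_real_indicator cong: Bochner_Integration.integral_cong)

lemma sym_box_sets [measurable]: "sym_box m \<in> sets borel"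
  unfolding sym_box_def by simp

lemma emeasure_sym_box_const: "emeasure lborel (sym_box (\<chi> i. r) :: (real^'d) set) = ennreal ((2 * r) ^ CARD('d))" if "0 \<le> r"
proof -
  have "emeasure lborel ((*v) (mat 1 :: real^'d^'d) ` sym_box (\<chi> i. r)) = ennreal (2 ^ CARD('d) * r ^ CARD('d))"
    using that by (subst emeasure_matrix_sym_box) auto
  then show ?thesis by (simp add: power_mult_distrib)
qed

lemma truncated_thresh_char_L1_L2:
  fixes x :: "nat \<Rightarrow> real^'d" and \<kappa> :: real
  assumes "n \<ge> 1"
  defines "h \<equiv> \<lambda>u. thresh_char \<kappa> n x u * indicator (sym_box (\<chi> i. real n)) u"
  shows "integrable lborel h" "is_L2 h"
proof -
  have i: "integrable lborel (indicator (sym_box (\<chi> i. real n)) :: real^'d \<Rightarrow> real)"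
    by (simp add: integrable_indicator_iff emeasure_sym_box_const)
  have [measurable]: "h \<in> borel_measurable borel" unfolding h_def by measurable
  have le: "norm (h u) \<le> indicator (sym_box (\<chi> i. real n)) u" for u
    using norm_thresh_char_le[OF assms(1), of \<kappa> x u] by (auto simp: h_def split: split_indicator)
  show "integrable lborel h"
    by (rule Bochner_Integration.integrable_bound[OF i]) (use le in auto)
  show "is_L2 h"
    unfolding is_L2_iff
  proof
    show "integrable lborel (\<lambda>u. (norm (h u))\<^sup>2)"
    proof (rule Bochner_Integration.integrable_bound[OF i])
      have "(norm (h u))\<^sup>2 \<le> indicator (sym_box (\<chi> i. real n)) u" for u
      proof -
        have "(norm (h u))\<^sup>2 \<le> (indicator (sym_box (\<chi> i. real n)) u)\<^sup>2"
          by (intro power_mono le) simp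
        also have "\<dots> = indicator (sym_box (\<chi> i. real n)) u" by (simp split: split_indicator)
        finally show ?thesis .
      qed
      then show "AE u in lborel. norm ((norm (h u))\<^sup>2) \<le> norm (indicator (sym_box (\<chi> i. real n)) u :: real)"
        by simp
    qed measurable
  qed measurable
qed

text \<open>
  Plancherel moves the loss to the Fourier side, where Tonelli's theorem allows the expectation to be taken
  frequency by frequency. The set \<open>S\<close> of retained frequencies appears only in the analysis, so the bound may be
  optimised over it. Outside the box the estimator vanishes and the loss is exactly the squared modulus of
  \<open>fourier f\<close>.
\<close>

lemma (in prob_space) integrated_risk_le:
  fixes X :: "nat \<Rightarrow> 'a \<Rightarrow> real^'d" and f :: "real^'d \<Rightarrow> complex" and n :: nat
  assumes n: "n \<ge> 1" and \<kappa>: "\<kappa> > 0" and indep: "indep_vars (\<lambda>_. borel) X {1..n}"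
    and char: "\<And>j u. j \<in> {1..n} \<Longrightarrow> expectation (\<lambda>\<omega>. iexp (u \<bullet> X j \<omega>)) = fourier f u"
    and f: "integrable lborel f" "is_L2 f"
    and S: "S \<in> sets borel" "S \<subseteq> sym_box (\<chi> i. real n)"
  shows "(\<integral>\<^sup>+\<omega>. L2_norm_sq (\<lambda>x. fourier_estimator \<kappa> n (\<lambda>j. X j \<omega>) x - f x) \<partial>M)
    \<le> ennreal (1 / (2 * pi) ^ CARD('d)) *
        (18 * L2_norm_sq (\<lambda>u. fourier f u * indicator (- S) u)
          + ennreal ((10 + 2 * (1 + (\<kappa> + 2) * sqrt (ln (real n)))\<^sup>2) / real n) * emeasure lborel S
          + ennreal (64 * real n powr (- \<kappa>\<^sup>2 / 4)) * emeasure lborel (sym_box (\<chi> i. real n) :: (real^'d) set))"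
    (is "_ \<le> ?c * (18 * _ + ennreal ?V * _ + ennreal ?R * emeasure _ ?Q)")
proof -
  let ?h = "\<lambda>\<omega> u. thresh_char \<kappa> n (\<lambda>j. X j \<omega>) u * indicator ?Q u"
  have X: "X j \<in> borel_measurable M" if "j \<in> {1..n}" for j
    using indep that unfolding indep_vars_def by auto
  have fm [measurable]: "fourier f \<in> borel_measurable borel"
    using f by (intro fourier_measurable) auto
  have [measurable]: "S \<in> sets borel" by (rule S)
  note [measurable] = thresh_char_measurable_pair[OF X, where \<kappa>=\<kappa>, unfolded split_beta]
  have "(\<integral>\<^sup>+\<omega>. L2_norm_sq (\<lambda>x. fourier_estimator \<kappa> n (\<lambda>j. X j \<omega>) x - f x) \<partial>M)
      = (\<integral>\<^sup>+\<omega>. ?c * (\<integral>\<^sup>+u. ennreal ((norm (?h \<omega> u - fourier f u))\<^sup>2) \<partial>lborel) \<partial>M)"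
    unfolding fourier_estimator_eq plancherel_mixed[OF f truncated_thresh_char_L1_L2[OF n]]
    unfolding L2_norm_sq_def ..
  also have "\<dots> = ?c * (\<integral>\<^sup>+\<omega>. (\<integral>\<^sup>+u. ennreal ((norm (?h \<omega> u - fourier f u))\<^sup>2) \<partial>lborel) \<partial>M)"
    by (rule nn_integral_cmult) measurable
  finally have risk: "(\<integral>\<^sup>+\<omega>. L2_norm_sq (\<lambda>x. fourier_estimator \<kappa> n (\<lambda>j. X j \<omega>) x - f x) \<partial>M)
      = ?c * (\<integral>\<^sup>+\<omega>. (\<integral>\<^sup>+u. ennreal ((norm (?h \<omega> u - fourier f u))\<^sup>2) \<partial>lborel) \<partial>M)" .
  have "(\<integral>\<^sup>+\<omega>. (\<integral>\<^sup>+u. ennreal ((norm (?h \<omega> u - fourier f u))\<^sup>2) \<partial>lborel) \<partial>M)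
      = (\<integral>\<^sup>+u. (\<integral>\<^sup>+\<omega>. ennreal ((norm (?h \<omega> u - fourier f u))\<^sup>2) \<partial>M) \<partial>lborel)"
  proof -
    interpret pair_sigma_finite M "lborel :: (real^'d) measure" ..
    have "(\<lambda>p. ennreal ((norm (?h (fst p) (snd p) - fourier f (snd p)))\<^sup>2)) \<in> borel_measurable (M \<Otimes>\<^sub>M lborel)"
      by measurable
    from Fubini[OF this] show ?thesis by simp
  qed
  also have "\<dots> \<le> (\<integral>\<^sup>+u. 18 * ennreal ((norm (fourier f u * indicator (- S) u))\<^sup>2)
      + ennreal ?V * indicator S u + ennreal ?R * indicator ?Q u \<partial>lborel)"
  proof (intro nn_integral_mono)
    fix u :: "real^'d"
    note risk = risk_le_variance[OF n indep char \<kappa>, of u] risk_le_bias[OF n indep char \<kappa>, of u]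
    have R: "ennreal (18 * (norm (fourier f u))\<^sup>2 + ?R) = 18 * ennreal ((norm (fourier f u))\<^sup>2) + ennreal ?R"
      by (subst ennreal_plus) (auto simp: ennreal_mult)
    consider "u \<in> S" "u \<in> ?Q" | "u \<notin> S" "u \<in> ?Q" | "u \<notin> S" "u \<notin> ?Q" using S(2) by blast
    then show "(\<integral>\<^sup>+\<omega>. ennreal ((norm (?h \<omega> u - fourier f u))\<^sup>2) \<partial>M)
        \<le> 18 * ennreal ((norm (fourier f u * indicator (- S) u))\<^sup>2) + ennreal ?V * indicator S u + ennreal ?R * indicator ?Q u"
    proof cases
      case 1
      then show ?thesis using risk(1) by (simp add: add_increasing2)
    next
      case 2
      then show ?thesis using risk(2) unfolding R by simp
    next
      case 3
      have "ennreal ((norm (fourier f u))\<^sup>2) \<le> 18 * ennreal ((norm (fourier f u))\<^sup>2)"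
        using mult_right_mono[of 1 18 "ennreal ((norm (fourier f u))\<^sup>2)"] by simp
      with 3 show ?thesis by (simp add: emeasure_space_1)
    qed
  qed
  also have "\<dots> = 18 * L2_norm_sq (\<lambda>u. fourier f u * indicator (- S) u)
      + ennreal ?V * emeasure lborel S + ennreal ?R * emeasure lborel ?Q"
    unfolding L2_norm_sq_def
    by (subst nn_integral_add, measurable, subst nn_integral_add, measurable) (simp add: nn_integral_cmult)
  finally show ?thesis unfolding risk by (intro mult_left_mono) simp_all
qed

theorem theorem2p1:
  fixes M :: "'w measure"
    and X :: "nat \<Rightarrow> 'w \<Rightarrow> real^'d"
    and f :: "real^'d \<Rightarrow> real"
    and n :: nat
    and \<kappa> :: real
  assumes "prob_space M"
    and "n \<ge> 1"
    and "\<kappa> > 0"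
    and "prob_space.indep_vars M (\<lambda>_. borel) X {1..n}"
    and "\<And>j. j \<in> {1..n} \<Longrightarrow> distributed M lborel (X j) (\<lambda>x. ennreal (f x))"
    and "AE x in lborel. 0 \<le> f x"
    and "integrable lborel f"
    and "integrable lborel (\<lambda>x. (f x)\<^sup>2)"
  shows "(\<integral>\<^sup>+ \<omega>. L2_norm_sq (\<lambda>x. fourier_estimator \<kappa> n (\<lambda>j. X j \<omega>) x - complex_of_real (f x)) \<partial>M)
    \<le> (INF (m, A) \<in> cbox 0 (\<chi> i. real n) \<times> matrix_class.
          18 * L2_norm_sq (\<lambda>x. complex_of_real (f x)
                                - spectral_cutoff (\<lambda>y. complex_of_real (f y)) A m x)
          + ennreal ((10 + 2 * (1 + (\<kappa> + 2) * sqrt (ln (real n)))\<^sup>2) * \<bar>det A\<bar>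
                      / (pi ^ CARD('d) * real n) * (\<Prod>i\<in>UNIV. m $ i)))
      + ennreal (64 / pi ^ CARD('d) * real n powr (real CARD('d) - \<kappa>\<^sup>2 / 4))"
    (is "?lhs \<le> (INF (m, A) \<in> ?I. ?B m A) + ennreal ?C")
proof -
  interpret prob_space M by fact
  let ?f = "\<lambda>x. complex_of_real (f x)" and ?K = "(2 * pi) ^ CARD('d)"
  let ?V = "(10 + 2 * (1 + (\<kappa> + 2) * sqrt (ln (real n)))\<^sup>2) / real n" and ?R = "64 * real n powr (- \<kappa>\<^sup>2 / 4)"
  let ?Q = "sym_box (\<chi> i. real n) :: (real^'d) set"
  have fm [measurable]: "f \<in> borel_measurable borel" using assms(7) by auto
  have f1: "integrable lborel ?f" using assms(7) by simp
  have f2: "is_L2 ?f" unfolding is_L2_iff using assms(8) by simp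
  have char: "expectation (\<lambda>\<omega>. iexp (u \<bullet> X j \<omega>)) = fourier ?f u" if "j \<in> {1..n}" for j u
    using that assms by (intro fourier_eq_expectation) auto
  have n: "real n > 0" using assms(2) by simp
  have bound: "?lhs \<le> ?B m A + ennreal ?C" if m: "m \<in> cbox 0 (\<chi> i. real n)" and A: "A \<in> matrix_class" for m A
  proof -
    let ?S = "(*v) A ` sym_box m"
    have m0: "0 \<le> m $ i" for i using m by (simp add: mem_box_cart)
    have Sm: "?S \<in> sets borel"
      using compact_matrix_sym_box by (rule borel_compact)
    have "?lhs \<le> ennreal (1 / ?K) * (18 * L2_norm_sq (\<lambda>u. fourier ?f u * indicator (- ?S) u)
        + ennreal ?V * emeasure lborel ?S + ennreal ?R * emeasure lborel ?Q)"
      by (intro integrated_risk_le assms(2,3,4) char f1 f2 Sm matrix_class_image_subset[OF A m n])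
    also have "\<dots> = 18 * (ennreal (1 / ?K) * L2_norm_sq (\<lambda>u. fourier ?f u * indicator (- ?S) u))
        + ennreal (1 / ?K) * (ennreal ?V * emeasure lborel ?S) + ennreal (1 / ?K) * (ennreal ?R * emeasure lborel ?Q)"
      by (simp only: distrib_left mult_ac)
    also have "\<dots> \<le> 18 * L2_norm_sq (\<lambda>x. ?f x - spectral_cutoff ?f A m x)
        + ennreal (1 / ?K) * (ennreal ?V * emeasure lborel ?S) + ennreal (1 / ?K) * (ennreal ?R * emeasure lborel ?Q)"
      by (intro add_mono mult_left_mono spectral_cutoff_error_ge f1 f2) auto
    also have "ennreal (1 / ?K) * (ennreal ?V * emeasure lborel ?S)
        = ennreal ((10 + 2 * (1 + (\<kappa> + 2) * sqrt (ln (real n)))\<^sup>2) * \<bar>det A\<bar>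
                      / (pi ^ CARD('d) * real n) * (\<Prod>i\<in>UNIV. m $ i))"
    proof -
      have "1 / ?K * (?V * (\<bar>det A\<bar> * (2 ^ CARD('d) * (\<Prod>i\<in>UNIV. m $ i))))
          = (10 + 2 * (1 + (\<kappa> + 2) * sqrt (ln (real n)))\<^sup>2) * \<bar>det A\<bar>
                      / (pi ^ CARD('d) * real n) * (\<Prod>i\<in>UNIV. m $ i)"
        unfolding power_mult_distrib using n by (simp add: field_simps)
      moreover have "0 \<le> (\<Prod>i\<in>UNIV. m $ i)" using m0 by (intro prod_nonneg) auto
      ultimately show ?thesis
        unfolding emeasure_matrix_sym_box[OF m0] using n by (simp add: ennreal_mult[symmetric])
    qed
    also have "ennreal (1 / ?K) * (ennreal ?R * emeasure lborel ?Q) = ennreal ?C"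
    proof -
      have "1 / ?K * (?R * (2 * real n) ^ CARD('d)) = ?C"
      proof -
        have "real n powr (real CARD('d) - \<kappa>\<^sup>2 / 4) = real n ^ CARD('d) * real n powr (- \<kappa>\<^sup>2 / 4)"
          using n by (simp add: powr_realpow[symmetric] powr_add[symmetric])
        then show ?thesis unfolding power_mult_distrib by (simp add: field_simps)
      qed
      then show ?thesis
        by (subst emeasure_sym_box_const) (auto simp: ennreal_mult[symmetric])
    qed
    finally show ?thesis .
  qed
  \<comment> \<open>Subtracting the finite constant moves it out of the infimum.\<close>
  have "?lhs - ennreal ?C \<le> (INF (m, A) \<in> ?I. ?B m A)"
  proof (rule INF_greatest)
    fix p assume "p \<in> ?I"
    then show "?lhs - ennreal ?C \<le> (case p of (m, A) \<Rightarrow> ?B m A)"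
      using bound by (auto simp: ennreal_minus_le_iff add.commute)
  qed
  then show ?thesis
    by (simp add: ennreal_minus_le_iff add.commute)
qed

end
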